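(* Let $(N,Q,C_1,C_2,\dots)$ be a nonnegative random vector with $N\in\mathbb N_+\cup\{\infty\}$ and $P(Q>0)>0$, and suppose that for some $\alpha>0$, $E\left[\sum_{i=1}^N C_i^\alpha\right]=1$ and $E\left[\sum_{i=1}^N C_i^\alpha\log C_i\right]\in(0,\infty)$. For all $k\ge1$ and $x_1,\dots,x_k,y\in\mathbb R\cup\{\infty\}$, $$\widetilde P\left(\hat X_1\le x_1,\dots,\hat X_k\le x_k,\ \xi_k\le y\right)=E\left[1(Q\le e^y)\sum_{i=1}^NC_i^\alpha\right]\prod_{r=1}^kG(x_r),$$ where $$G(x)=\sum_{i=1}^\infty E\left[1(C_i\le e^x,\ N\ge i)C_i^\alpha\right]=E\left[\sum_{i=1}^N1(\log C_i\le x)C_i^\alpha\right].$$ In particular, under $\widetilde P$ the $\{\hat X_i:i\ge1\}$ are i.i.d. with common distribution function $G$, $\widetilde E\left[|\hat X_1|\right]<\infty$, and they have mean $$\mu:=\widetilde E\left[\hat X_1\right]=E\left[\sum_{i=1}^NC_i^\alpha\log C_i\right]\in(0,\infty).$$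
   Context: Conventions: $\log0=-\infty$, $0\cdot\log0=0$, $e^\infty=\infty$. Weighted branching tree. Let $U=\bigcup_{k\ge0}\mathbb N_+^k$ be the set of finite sequences of positive integers ($\mathbb N_+^0=\{\emptyset\}$); $(\boldsymbol i,j)$ is concatenation. Let $\boldsymbol\psi_{\boldsymbol i}=(N_{\boldsymbol i},Q_{\boldsymbol i},C_{(\boldsymbol i,1)},C_{(\boldsymbol i,2)},\dots)$, $\boldsymbol i\in U$, be i.i.d. copies of $\boldsymbol\psi=(N,Q,C_1,C_2,\dots)$ (arbitrary dependence within the vector is allowed). Let $A_0=\{\emptyset\}$, $A_n=\{(\boldsymbol i,j):\boldsymbol i\in A_{n-1},\,j\in\mathbb N_+,\,1\le j\le N_{\boldsymbol i}\}$. Spine. Let $D_{\boldsymbol i}=\sum_{r=1}^{N_{\boldsymbol i}}C_{(\boldsymbol i,r)}^\alpha$. Set $\boldsymbol J_0=\emptyset$ and, conditionally on all the $\{\boldsymbol\psi_{\boldsymbol i}\}$ and on $\boldsymbol J_0,\dots,\boldsymbol J_{k-1}$, let $\boldsymbol J_k=(\boldsymbol J_{k-1},i)$ with probability $C_{(\boldsymbol J_{k-1},i)}^\alpha/D_{\boldsymbol J_{k-1}}$, $1\le i\le N_{\boldsymbol J_{k-1}}$, $k\ge1$ (on $\{D_{\boldsymbol J_{k-1}}=0\}$, which has $\widetilde P$-probability $0$, set $\boldsymbol J_k=(\boldsymbol J_{k-1},1)$). Let $\hat X_k=\log C_{\boldsymbol J_k}$ for $k\ge1$ and $\xi_k=\log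 Q_{\boldsymbol J_k}$ for $k\ge0$. Change of measure. Let $\mathcal F_k=\sigma(\boldsymbol\psi_{\boldsymbol i}:\boldsymbol i\in A_s,\,s<k)$, $\mathcal G_k=\sigma(\mathcal F_k\cup\sigma(\boldsymbol J_s:s\le k))$ for $k\ge1$, $\mathcal F_0=\mathcal G_0$ trivial, and $L_0=1$, $L_k=\prod_{r=0}^{k-1}D_{\boldsymbol J_r}$, a mean-one nonnegative $(\mathcal G_k)$-martingale under $P$. $\widetilde P$ is the probability measure on $\sigma(\bigcup_k\mathcal G_k)$ with $\widetilde P(A)=E[1(A)L_k]$ for $A\in\mathcal G_k$, $k\ge0$; $\widetilde E$ is its expectation.
   Formalization: The condition that the expectation of the sum of C_i^α log C_i is in (0,∞) is read with absolute convergence: the expected sum of C_i^α |log C_i| is also assumed finite, since otherwise cancellation within the sum can make the expectation of |X_1| under the tilted measure infinite. *)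

theory Defs
  imports "HOL-Probability.Probability"
begin

text \<open>Logarithm and exponential with \<open>log 0 = -\<infinity>\<close> and \<open>e\<^sup>\<infinity> = \<infinity>\<close>; \<open>elog\<close> is only applied to
  nonnegative reals.\<close>

definition elog :: "real \<Rightarrow> ereal" where
  "elog c = (if c = 0 then -\<infinity> else ereal (ln c))"

definition eexp :: "ereal \<Rightarrow> ereal" where
  "eexp y = (case y of ereal r \<Rightarrow> ereal (exp r) | PInfty \<Rightarrow> \<infinity> | MInfty \<Rightarrow> 0)"

text \<open>\<open>esum n f\<close> is the sum of \<open>f i\<close> over \<open>1 \<le> i \<le> n\<close>, where \<open>n\<close> may be infinite.\<close>

definition esum :: "enat \<Rightarrow> (nat \<Rightarrow> 'c) \<Rightarrow> 'c::{topological_space, comm_monoid_add}" where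
  "esum n f = (\<Sum>i. if enat (Suc i) \<le> n then f (Suc i) else 0)"

text \<open>A mark is a value of the vector \<open>(N, Q, C\<^sub>1, C\<^sub>2, \<dots>)\<close>. The constraints \<open>N \<ge> 1\<close>, \<open>Q \<ge> 0\<close>,
  \<open>C\<^sub>i \<ge> 0\<close> are part of the space, so they hold surely for every random element of it. The weight
  sequences are indexed by \<open>{1..}\<close>.\<close>

type_synonym mark = "enat \<times> real \<times> (nat \<Rightarrow> real)"

definition mark_space :: "mark measure" where
  "mark_space = count_space {1..} \<Otimes>\<^sub>M restrict_space borel {0..} \<Otimes>\<^sub>M
     (\<Pi>\<^sub>M i\<in>{1..}. restrict_space borel {0..})"

definition mark_vector ::
    "('b \<Rightarrow> enat) \<Rightarrow> ('b \<Rightarrow> real) \<Rightarrow> (nat \<Rightarrow> 'b \<Rightarrow> real) \<Rightarrow> 'b \<Rightarrow> mark" where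
  "mark_vector N Q C = (\<lambda>\<omega>. (N \<omega>, Q \<omega>, \<lambda>i\<in>{1..}. C i \<omega>))"

text \<open>Individuals are finite sequences of positive integers; the \<open>j\<close>-th child of \<open>v\<close> is \<open>v @ [j]\<close>.\<close>

definition individuals :: "nat list set" where
  "individuals = lists {1..}"

definition offspring :: "(nat list \<Rightarrow> 'a \<Rightarrow> mark) \<Rightarrow> nat list \<Rightarrow> 'a \<Rightarrow> enat" where
  "offspring \<psi> v \<omega> = fst (\<psi> v \<omega>)"

definition toll :: "(nat list \<Rightarrow> 'a \<Rightarrow> mark) \<Rightarrow> nat list \<Rightarrow> 'a \<Rightarrow> real" where
  "toll \<psi> v \<omega> = fst (snd (\<psi> v \<omega>))"

text \<open>The weight \<open>C\<^bsub>(v,j)\<^esub>\<close> of the individual \<open>v @ [j]\<close> is a component of the mark of its parent \<open>v\<close>;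
  the root has no weight.\<close>

definition weight :: "(nat list \<Rightarrow> 'a \<Rightarrow> mark) \<Rightarrow> nat list \<Rightarrow> 'a \<Rightarrow> real" where
  "weight \<psi> v \<omega> = snd (snd (\<psi> (butlast v) \<omega>)) (last v)"

fun generation :: "(nat list \<Rightarrow> 'a \<Rightarrow> mark) \<Rightarrow> nat \<Rightarrow> 'a \<Rightarrow> nat list set" where
  "generation \<psi> 0 \<omega> = {[]}"
| "generation \<psi> (Suc n) \<omega> =
     {v @ [j] | v j. v \<in> generation \<psi> n \<omega> \<and> 1 \<le> j \<and> enat j \<le> offspring \<psi> v \<omega>}"

definition weight_sum :: "real \<Rightarrow> (nat list \<Rightarrow> 'a \<Rightarrow> mark) \<Rightarrow> nat list \<Rightarrow> 'a \<Rightarrow> ennreal" where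
  "weight_sum \<alpha> \<psi> v \<omega> = esum (offspring \<psi> v \<omega>) (\<lambda>r. ennreal (weight \<psi> (v @ [r]) \<omega> powr \<alpha>))"

locale weighted_branching_tree = prob_space P
  for P :: "'a measure" and \<psi> :: "nat list \<Rightarrow> 'a \<Rightarrow> mark" and law :: "mark measure" +
  assumes marks_indep: "indep_vars (\<lambda>_. mark_space) \<psi> individuals"
    and marks_law: "\<And>v. v \<in> individuals \<Longrightarrow> distr P mark_space (\<psi> v) = law"

text \<open>The information about all marks and about \<open>J\<^sub>0, \<dots>, J\<^sub>k\<close>, on which the choice of \<open>J\<^bsub>k+1\<^esub>\<close> is
  conditioned.\<close>

definition spine_past ::
    "'a measure \<Rightarrow> (nat list \<Rightarrow> 'a \<Rightarrow> mark) \<Rightarrow> (nat \<Rightarrow> 'a \<Rightarrow> nat list) \<Rightarrow> nat \<Rightarrow> 'a measure" where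
  "spine_past P \<psi> J k = sigma (space P)
     ({\<psi> v -` B \<inter> space P | v B. v \<in> individuals \<and> B \<in> sets mark_space} \<union>
      {J s -` {v} \<inter> space P | s v. s \<le> k})"

text \<open>The spine is required to move to an actual child surely, and not just almost surely as the
  transition probabilities imply: the \<open>\<sigma>\<close>-algebras of the filtration below are not completed, and
  the marks read along the spine would otherwise not be measurable with respect to them.\<close>

locale spine = weighted_branching_tree P \<psi> law
  for P :: "'a measure" and \<psi> :: "nat list \<Rightarrow> 'a \<Rightarrow> mark" and law :: "mark measure" +
  fixes \<alpha> :: real and J :: "nat \<Rightarrow> 'a \<Rightarrow> nat list"
  assumes spine_measurable: "\<And>k. J k \<in> measurable P (count_space UNIV)"
    and spine_root: "\<And>\<omega>. \<omega> \<in> space P \<Longrightarrow> J 0 \<omega> = []"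
    and spine_child: "\<And>k \<omega>. \<omega> \<in> space P \<Longrightarrow>
          \<exists>i\<ge>1. enat i \<le> offspring \<psi> (J k \<omega>) \<omega> \<and> J (Suc k) \<omega> = J k \<omega> @ [i]"
    and spine_degenerate: "\<And>k \<omega>. \<omega> \<in> space P \<Longrightarrow> weight_sum \<alpha> \<psi> (J k \<omega>) \<omega> = 0 \<Longrightarrow>
          J (Suc k) \<omega> = J k \<omega> @ [1]"
    and spine_transition: "\<And>k i. i \<ge> 1 \<Longrightarrow> AE \<omega> in P.
          weight_sum \<alpha> \<psi> (J k \<omega>) \<omega> \<noteq> 0 \<longrightarrow> enat i \<le> offspring \<psi> (J k \<omega>) \<omega> \<longrightarrow>
            real_cond_exp P (spine_past P \<psi> J k)
              (indicat_real {\<omega> \<in> space P. J (Suc k) \<omega> = J k \<omega> @ [i]}) \<omega> =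
            weight \<psi> (J k \<omega> @ [i]) \<omega> powr \<alpha> / enn2real (weight_sum \<alpha> \<psi> (J k \<omega>) \<omega>)"

text \<open>The \<open>\<sigma>\<close>-algebra \<open>F\<^sub>k\<close> of the marks of the individuals in the first \<open>k\<close> generations. As the
  generations are random sets, it is generated by the events that \<open>v\<close> belongs to its generation and
  that its mark then lies in \<open>B\<close>.\<close>

definition tree_events :: "'a measure \<Rightarrow> (nat list \<Rightarrow> 'a \<Rightarrow> mark) \<Rightarrow> nat \<Rightarrow> 'a set set" where
  "tree_events P \<psi> k =
     {{\<omega> \<in> space P. v \<in> generation \<psi> s \<omega> \<and> \<psi> v \<omega> \<in> B} | v s B.
        s < k \<and> v \<in> individuals \<and> B \<in> sets mark_space}"

text \<open>The filtration \<open>G\<^sub>k\<close>; for \<open>k = 0\<close> it is trivial because \<open>J\<^sub>0\<close> is constant.\<close>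

definition spine_filtration ::
    "'a measure \<Rightarrow> (nat list \<Rightarrow> 'a \<Rightarrow> mark) \<Rightarrow> (nat \<Rightarrow> 'a \<Rightarrow> nat list) \<Rightarrow> nat \<Rightarrow> 'a measure" where
  "spine_filtration P \<psi> J k = sigma (space P)
     (tree_events P \<psi> k \<union> {J s -` {v} \<inter> space P | s v. s \<le> k})"

definition spine_density ::
    "real \<Rightarrow> (nat list \<Rightarrow> 'a \<Rightarrow> mark) \<Rightarrow> (nat \<Rightarrow> 'a \<Rightarrow> nat list) \<Rightarrow> nat \<Rightarrow> 'a \<Rightarrow> ennreal" where
  "spine_density \<alpha> \<psi> J k \<omega> = (\<Prod>r<k. weight_sum \<alpha> \<psi> (J r \<omega>) \<omega>)"

locale spine_change_of_measure = spine P \<psi> law \<alpha> J + tilted: prob_space Pt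
  for P :: "'a measure" and \<psi> :: "nat list \<Rightarrow> 'a \<Rightarrow> mark" and law :: "mark measure"
    and \<alpha> :: real and J :: "nat \<Rightarrow> 'a \<Rightarrow> nat list" and Pt :: "'a measure" +
  assumes tilted_space: "space Pt = space P"
    and tilted_sets: "sets Pt = sigma_sets (space P) (\<Union>k. sets (spine_filtration P \<psi> J k))"
    and tilted_emeasure: "\<And>k A. A \<in> sets (spine_filtration P \<psi> J k) \<Longrightarrow>
          emeasure Pt A = (\<integral>\<^sup>+\<omega>. indicator A \<omega> * spine_density \<alpha> \<psi> J k \<omega> \<partial>P)"

text \<open>The processes \<open>X\<^sub>k\<close> (meant for \<open>k \<ge> 1\<close>) and \<open>\<xi>\<^sub>k\<close> along the spine.\<close>

definition spine_step ::
    "(nat list \<Rightarrow> 'a \<Rightarrow> mark) \<Rightarrow> (nat \<Rightarrow> 'a \<Rightarrow> nat list) \<Rightarrow> nat \<Rightarrow> 'a \<Rightarrow> ereal" where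
  "spine_step \<psi> J k \<omega> = elog (weight \<psi> (J k \<omega>) \<omega>)"

definition spine_perturbation ::
    "(nat list \<Rightarrow> 'a \<Rightarrow> mark) \<Rightarrow> (nat \<Rightarrow> 'a \<Rightarrow> nat list) \<Rightarrow> nat \<Rightarrow> 'a \<Rightarrow> ereal" where
  "spine_perturbation \<psi> J k \<omega> = elog (toll \<psi> (J k \<omega>) \<omega>)"

definition spine_cdf ::
    "'b measure \<Rightarrow> ('b \<Rightarrow> enat) \<Rightarrow> (nat \<Rightarrow> 'b \<Rightarrow> real) \<Rightarrow> real \<Rightarrow> ereal \<Rightarrow> ennreal" where
  "spine_cdf R N C \<alpha> x = esum \<infinity> (\<lambda>i.
     \<integral>\<^sup>+\<omega>. indicator {\<omega> \<in> space R. ereal (C i \<omega>) \<le> eexp x \<and> enat i \<le> N \<omega>} \<omega> *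
           ennreal (C i \<omega> powr \<alpha>) \<partial>R)"

end

theory Submission
  imports Defs
begin

text \<open>Fix a path \<open>v = (v\<^sub>1, \<dots>, v\<^sub>k)\<close> in the tree. Given all marks, the spine follows it with probability
  \<open>\<Prod>\<^sub>s C\<^sup>\<alpha> / D\<close>, where \<open>D\<close> is taken at the individual left and \<open>C\<close> is the weight of the child entered. On
  that event the density \<open>L\<^sub>k\<close> is \<open>\<Prod>\<^sub>s D\<close>, and the denominators cancel
  (\<open>nn_integral_spine_step\<close>, \<open>nn_integral_spine_path\<close>):
  \<open>E[1(J\<^sub>k = v) L\<^sub>k W] = E[W \<Prod>\<^sub>s 1(v\<^sub>s \<le> N) C\<^sup>\<alpha>]\<close>
  for every nonnegative function \<open>W\<close> of the marks. The individuals on a fixed path have independent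
  marks, so if \<open>W\<close> is a product of functions of the single marks, the expectation on the right
  factorises (\<open>nn_integral_marks_along_path\<close>). Summing over all paths turns the product into a product
  of sums over children, \<open>E[\<Sum>\<^bsub>i\<le>N\<^esub> C\<^sub>i\<^sup>\<alpha> f(\<psi>, i)]\<close>, one for each generation
  (\<open>nn_integral_along_spine\<close>).

  Hence, under the tilted measure, the pairs of the mark of \<open>J\<^sub>s\<close> and the rank of \<open>J\<^bsub>s+1\<^esub>\<close> among its
  siblings are i.i.d. with this size-biased law (\<open>nn_integral_tilted_spine\<close>), and the increments, which
  are functions of these pairs, are i.i.d. as well. The mark of \<open>J\<^sub>k\<close> is read without the choice of a
  child and is biased only by its own \<open>D\<close>, which is where the first factor of the joint law comes from.
  All computations are done for nonnegative integrands, so that Tonelli's theorem applies freely; only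
  the mean needs a decomposition into positive and negative parts.\<close>

section \<open>Sums over children as functions of a mark\<close>

lemma nn_integral_positive_integers:
  fixes f :: "nat \<Rightarrow> ennreal"
  shows "(\<integral>\<^sup>+i. f i \<partial>count_space {1..}) = (\<Sum>i. f (Suc i))"
proof -
  have "bij_betw Suc UNIV {1..}"
    by (rule bij_betwI[where g = "\<lambda>n. n - 1"]) auto
  from nn_integral_bij_count_space[OF this, of f]
  show ?thesis by (simp add: nn_integral_count_space_nat)
qed

text \<open>Sums over children are handled as integrals with respect to counting measure, because they
  are to be interchanged with expectations.\<close>

lemma esum_ennreal_eq_nn_integral:
  fixes f :: "nat \<Rightarrow> ennreal"
  shows "esum n f = (\<integral>\<^sup>+i. (if enat i \<le> n then f i else 0) \<partial>count_space {1..})"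
  unfolding esum_def nn_integral_positive_integers ..

text \<open>\<open>child_factor\<close> is the density, with respect to the law of a mark times counting measure, with which the
  tilted spine picks a mark and a child; \<open>total_factor\<close> is the random variable \<open>D\<close>.\<close>

definition child_factor :: "real \<Rightarrow> mark \<Rightarrow> nat \<Rightarrow> ennreal" where
  "child_factor \<alpha> m i = (if enat i \<le> fst m then ennreal (snd (snd m) i powr \<alpha>) else 0)"

definition total_factor :: "real \<Rightarrow> mark \<Rightarrow> ennreal" where
  "total_factor \<alpha> m = (\<integral>\<^sup>+i. child_factor \<alpha> m i \<partial>count_space {1..})"

lemma weight_sum_eq_total_factor: "weight_sum \<alpha> \<psi> v \<omega> = total_factor \<alpha> (\<psi> v \<omega>)"
  by (simp add: weight_sum_def total_factor_def child_factor_def esum_ennreal_eq_nn_integral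
      offspring_def weight_def)

lemma child_factor_le_total_factor: "i \<ge> 1 \<Longrightarrow> child_factor \<alpha> m i \<le> total_factor \<alpha> m"
  unfolding total_factor_def
  using nn_integral_ge_point[of i "{1..}" "child_factor \<alpha> m"] by simp

lemma measurable_mark_offspring [measurable]: "fst \<in> measurable mark_space (count_space {1..})"
  unfolding mark_space_def by measurable

lemma measurable_mark_toll [measurable]: "(\<lambda>m. fst (snd m)) \<in> borel_measurable mark_space"
proof -
  have "(\<lambda>m. fst (snd m)) \<in> measurable mark_space (restrict_space borel {0..})"
    unfolding mark_space_def by measurable
  then show ?thesis by (simp add: measurable_restrict_space2_iff)
qed

lemma measurable_mark_weight:
  assumes "i \<ge> 1"
  shows "(\<lambda>m. snd (snd m) i) \<in> borel_measurable mark_space"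
proof -
  have "(\<lambda>m. snd (snd m) i) \<in> measurable mark_space (restrict_space borel {0..})"
    unfolding mark_space_def using assms
    by (intro measurable_compose[OF measurable_snd[THEN measurable_compose, OF measurable_snd]]
        measurable_component_singleton) simp
  then show ?thesis by (simp add: measurable_restrict_space2_iff)
qed

lemma pred_mark_offspring: "Measurable.pred mark_space (\<lambda>m. enat i \<le> fst m)"
  by (rule measurable_compose[OF measurable_mark_offspring]) simp

lemma measurable_child_factor:
  assumes "i \<ge> 1"
  shows "(\<lambda>m. child_factor \<alpha> m i) \<in> borel_measurable mark_space"
proof -
  note [measurable] = measurable_mark_weight[OF assms] pred_mark_offspring
  show ?thesis unfolding child_factor_def by measurable
qed

lemma measurable_nn_integral_children:
  fixes f :: "mark \<Rightarrow> nat \<Rightarrow> ennreal"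
  assumes "\<And>i. i \<ge> 1 \<Longrightarrow> (\<lambda>m. f m i) \<in> borel_measurable mark_space"
  shows "(\<lambda>m. \<integral>\<^sup>+i. f m i \<partial>count_space {1..}) \<in> borel_measurable mark_space"
proof -
  have [measurable]: "(\<lambda>m. f m (Suc i)) \<in> borel_measurable mark_space" for i
    by (rule assms) simp
  show ?thesis unfolding nn_integral_positive_integers by measurable
qed

lemma measurable_total_factor [measurable]: "total_factor \<alpha> \<in> borel_measurable mark_space"
  unfolding total_factor_def by (intro measurable_nn_integral_children measurable_child_factor)

lemma space_mark_weight_nonneg: "m \<in> space mark_space \<Longrightarrow> i \<ge> 1 \<Longrightarrow> snd (snd m) i \<ge> 0"
  by (auto simp: mark_space_def space_pair_measure space_PiM)

section \<open>Independent marks along a fixed path\<close>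

lemma individuals_snoc [simp]: "v @ [i] \<in> individuals \<longleftrightarrow> v \<in> individuals \<and> i \<ge> 1"
  by (auto simp: individuals_def)

lemma take_individuals [simp]: "v \<in> individuals \<Longrightarrow> take s v \<in> individuals"
  by (auto simp: individuals_def dest: in_set_takeD)

lemma individuals_nth: "v \<in> individuals \<Longrightarrow> s < length v \<Longrightarrow> v ! s \<ge> 1"
  using nth_mem[of s v] by (auto simp: individuals_def)

lemma countable_individuals: "countable (individuals :: nat list set)"
  by (rule countableI_type)

context weighted_branching_tree begin

lemma measurable_mark: "v \<in> individuals \<Longrightarrow> \<psi> v \<in> measurable P mark_space"
  using marks_indep by (auto simp: indep_vars_def2)

lemma law_eq_distr: "law = distr P mark_space (\<psi> [])"
  using marks_law[of "[]"] by (simp add: individuals_def)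

lemma sets_law [simp, measurable_cong]: "sets law = sets mark_space"
  by (simp add: law_eq_distr)

lemma nn_integral_mark:
  assumes "v \<in> individuals" "h \<in> borel_measurable mark_space"
  shows "(\<integral>\<^sup>+\<omega>. h (\<psi> v \<omega>) \<partial>P) = (\<integral>\<^sup>+m. h m \<partial>law)"
  using assms by (subst marks_law[OF assms(1), symmetric])
    (simp add: nn_integral_distr measurable_mark)

text \<open>The prefixes of \<open>v\<close> are distinct individuals, so their marks are independent copies of \<open>\<psi>\<close>.\<close>

lemma nn_integral_marks_along_path:
  fixes g :: "nat \<Rightarrow> mark \<Rightarrow> ennreal" and h :: "mark \<Rightarrow> ennreal"
  assumes v: "v \<in> individuals"
    and g: "\<And>s. s < length v \<Longrightarrow> g s \<in> borel_measurable mark_space"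
    and h: "h \<in> borel_measurable mark_space"
  shows "(\<integral>\<^sup>+\<omega>. (\<Prod>s<length v. g s (\<psi> (take s v) \<omega>)) * h (\<psi> v \<omega>) \<partial>P) =
    (\<Prod>s<length v. \<integral>\<^sup>+m. g s m \<partial>law) * (\<integral>\<^sup>+m. h m \<partial>law)"
proof -
  define n where "n = length v"
  define g' where "g' s = (if s < n then g s else h)" for s
  have g': "g' s \<in> borel_measurable mark_space" for s
    using g h by (simp add: g'_def n_def)
  have inj: "inj_on (\<lambda>s. take s v) {..n}"
    by (rule inj_on_inverseI[where g = length]) (simp add: n_def)
  let ?I = "(\<lambda>s. take s v) ` {..n}"
  have "indep_vars (\<lambda>_. mark_space) \<psi> ?I"
    by (rule indep_vars_subset[OF marks_indep]) (use v in auto)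
  then have "indep_vars (\<lambda>_. borel) (\<lambda>w \<omega>. g' (length w) (\<psi> w \<omega>)) ?I"
    by (rule indep_vars_compose2) (use g' in simp)
  then have "(\<integral>\<^sup>+\<omega>. (\<Prod>w\<in>?I. g' (length w) (\<psi> w \<omega>)) \<partial>P) =
      (\<Prod>w\<in>?I. \<integral>\<^sup>+\<omega>. g' (length w) (\<psi> w \<omega>) \<partial>P)"
    by (intro indep_vars_nn_integral) auto
  also have "\<dots> = (\<Prod>w\<in>?I. \<integral>\<^sup>+m. g' (length w) m \<partial>law)"
    using v by (intro prod.cong refl nn_integral_mark g') auto
  finally have "(\<integral>\<^sup>+\<omega>. (\<Prod>s\<le>n. g' s (\<psi> (take s v) \<omega>)) \<partial>P) = (\<Prod>s\<le>n. \<integral>\<^sup>+m. g' s m \<partial>law)"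
    by (simp add: prod.reindex[OF inj] min_absorb2 flip: n_def cong: prod.cong_simp)
  then show ?thesis
    by (simp add: lessThan_Suc_atMost[symmetric] g'_def n_def)
qed

end

section \<open>The spine follows a given path\<close>

context spine begin

lemma spine_length: "\<omega> \<in> space P \<Longrightarrow> length (J k \<omega>) = k"
proof (induction k)
  case (Suc k)
  then show ?case using spine_child[of \<omega> k] by auto
qed (simp add: spine_root)

lemma spine_individual: "\<omega> \<in> space P \<Longrightarrow> J k \<omega> \<in> individuals"
proof (induction k)
  case (Suc k)
  then show ?case using spine_child[of \<omega> k] by auto
qed (simp add: spine_root individuals_def)

lemma spine_prefix: "\<omega> \<in> space P \<Longrightarrow> s \<le> k \<Longrightarrow> take s (J k \<omega>) = J s \<omega>"
proof (induction k)
  case (Suc k)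
  obtain i where i: "J (Suc k) \<omega> = J k \<omega> @ [i]" using spine_child[OF Suc.prems(1)] by blast
  show ?case
  proof (cases "s = Suc k")
    case True then show ?thesis using spine_length[OF Suc.prems(1), of "Suc k"] by simp
  next
    case False
    then show ?thesis using Suc i spine_length[OF Suc.prems(1), of k] by simp
  qed
qed (simp add: spine_root)

lemma spine_last: "\<omega> \<in> space P \<Longrightarrow> s < k \<Longrightarrow> last (J (Suc s) \<omega>) = J k \<omega> ! s"
  using spine_prefix[of \<omega> "Suc s" k, symmetric] spine_length[of \<omega> k]
  by (simp add: take_Suc_conv_app_nth)

lemma spine_snoc: "\<omega> \<in> space P \<Longrightarrow> J (Suc k) \<omega> = J k \<omega> @ [last (J (Suc k) \<omega>)]"
  using spine_child[of \<omega> k] by auto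

lemma spine_last_ge_1: "\<omega> \<in> space P \<Longrightarrow> last (J (Suc k) \<omega>) \<ge> 1"
  using spine_child[of \<omega> k] by auto

lemma space_spine_past [simp]: "space (spine_past P \<psi> J k) = space P"
  unfolding spine_past_def by (intro space_measure_of) auto

lemma sets_spine_past: "sets (spine_past P \<psi> J k) = sigma_sets (space P)
     ({\<psi> v -` B \<inter> space P | v B. v \<in> individuals \<and> B \<in> sets mark_space} \<union>
      {J s -` {v} \<inter> space P | s v. s \<le> k})"
  unfolding spine_past_def by (intro sets_measure_of) auto

lemma subalgebra_spine_past: "subalgebra P (spine_past P \<psi> J k)"
proof -
  have "sets (spine_past P \<psi> J k) \<subseteq> sets P"
    unfolding sets_spine_past
    by (intro sets.sigma_sets_subset)
       (auto intro!: measurable_sets[OF measurable_mark] measurable_sets[OF spine_measurable])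
  then show ?thesis by (simp add: subalgebra_def)
qed

lemma sigma_finite_spine_past: "sigma_finite_subalgebra P (spine_past P \<psi> J k)"
proof (rule finite_measure_subalgebra_is_sigma_finite)
  show "finite_measure_subalgebra P (spine_past P \<psi> J k)"
    by unfold_locales (rule subalgebra_spine_past)
qed

lemma measurable_mark_past: "v \<in> individuals \<Longrightarrow> \<psi> v \<in> measurable (spine_past P \<psi> J k) mark_space"
  by (intro measurableI)
     (auto simp: sets_spine_past intro: measurable_space[OF measurable_mark] intro!: sigma_sets.Basic)

lemma measurable_spine_past:
  "s \<le> k \<Longrightarrow> J s \<in> measurable (spine_past P \<psi> J k) (count_space UNIV)"
  by (subst measurable_count_space_eq2_countable)
     (auto simp: sets_spine_past intro!: sigma_sets.Basic)

text \<open>\<open>J\<^sub>0\<close> being constant, \<open>spine_past P \<psi> J 0\<close> is the \<open>\<sigma>\<close>-algebra of the marks alone.\<close>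

lemma spine_past_0_le:
  assumes "W \<in> borel_measurable (spine_past P \<psi> J 0)"
  shows "W \<in> borel_measurable (spine_past P \<psi> J k)"
proof -
  have "sets (spine_past P \<psi> J 0) \<subseteq> sets (spine_past P \<psi> J k)"
    unfolding sets_spine_past by (intro sigma_sets_mono') auto
  then have "subalgebra (spine_past P \<psi> J k) (spine_past P \<psi> J 0)"
    by (simp add: subalgebra_def)
  then show ?thesis using assms by (rule measurable_from_subalg)
qed

text \<open>On \<open>D = \<infinity>\<close> the transition probabilities carry no information, as \<open>enn2real \<infinity> = 0\<close>; a finite
  mean of \<open>D\<close> makes this event negligible.\<close>

lemma AE_total_factor_finite:
  assumes "(\<integral>\<^sup>+m. total_factor \<alpha> m \<partial>law) < \<infinity>" "v \<in> individuals"
  shows "AE \<omega> in P. total_factor \<alpha> (\<psi> v \<omega>) \<noteq> \<infinity>"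
proof (rule nn_integral_PInf_AE)
  show "(\<lambda>\<omega>. total_factor \<alpha> (\<psi> v \<omega>)) \<in> borel_measurable P"
    by (rule measurable_compose[OF measurable_mark[OF assms(2)] measurable_total_factor])
  show "(\<integral>\<^sup>+\<omega>. total_factor \<alpha> (\<psi> v \<omega>) \<partial>P) \<noteq> \<infinity>"
    using assms by (simp add: nn_integral_mark)
qed

text \<open>This moves the transition law of the spine, which speaks of the real conditional expectation, to
  the nonnegative extended one, whose defining property holds for all nonnegative test functions
  without integrability conditions.\<close>

lemma nn_cond_exp_indicator:
  assumes "A \<in> sets P"
  shows "AE \<omega> in P. nn_cond_exp P (spine_past P \<psi> J k) (\<lambda>\<omega>. ennreal (indicat_real A \<omega>)) \<omega> =
    ennreal (real_cond_exp P (spine_past P \<psi> J k) (indicat_real A) \<omega>)"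
proof -
  let ?F = "spine_past P \<psi> J k"
  interpret S: sigma_finite_subalgebra P ?F by (rule sigma_finite_spine_past)
  have m: "(\<lambda>\<omega>. ennreal (indicat_real A \<omega>)) \<in> borel_measurable P" using assms by simp
  have neg: "AE \<omega> in P. (0::ennreal) = nn_cond_exp P ?F (\<lambda>\<omega>. ennreal (- indicat_real A \<omega>)) \<omega>"
    using S.nn_cond_exp_F_meas[of "\<lambda>_. 0"] by (simp add: ennreal_neg)
  have fin: "AE \<omega> in P. nn_cond_exp P ?F (\<lambda>\<omega>. ennreal (indicat_real A \<omega>)) \<omega> \<noteq> \<infinity>"
  proof (rule nn_integral_PInf_AE)
    have "(\<integral>\<^sup>+\<omega>. nn_cond_exp P ?F (\<lambda>\<omega>. ennreal (indicat_real A \<omega>)) \<omega> \<partial>P) = emeasure P A"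
      using S.nn_cond_exp_intg[of "\<lambda>_. 1", OF _ m] assms by (simp add: ennreal_indicator)
    then show "(\<integral>\<^sup>+\<omega>. nn_cond_exp P ?F (\<lambda>\<omega>. ennreal (indicat_real A \<omega>)) \<omega> \<partial>P) \<noteq> \<infinity>"
      by simp
  qed simp
  show ?thesis using neg fin
    by eventually_elim (auto simp: real_cond_exp_def less_top)
qed

text \<open>The cancellation behind the change of measure: given the past, the step to the \<open>i\<close>-th child has
  probability \<open>C\<^sub>i\<^sup>\<alpha> / D\<close>, and the density contributes the factor \<open>D\<close>. Where \<open>D = 0\<close> both sides
  vanish, since then \<open>C\<^sub>i\<^sup>\<alpha> = 0\<close> for every child.\<close>

lemma nn_integral_spine_step:
  assumes fin: "(\<integral>\<^sup>+m. total_factor \<alpha> m \<partial>law) < \<infinity>"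
    and v: "v \<in> individuals" and i: "i \<ge> 1"
    and V: "V \<in> borel_measurable (spine_past P \<psi> J k)"
  shows "(\<integral>\<^sup>+\<omega>. V \<omega> * total_factor \<alpha> (\<psi> v \<omega>) * indicator {\<omega>. J (Suc k) \<omega> = v @ [i]} \<omega> \<partial>P) =
    (\<integral>\<^sup>+\<omega>. V \<omega> * child_factor \<alpha> (\<psi> v \<omega>) i * indicator {\<omega>. J k \<omega> = v} \<omega> \<partial>P)"
proof -
  let ?F = "spine_past P \<psi> J k"
  define A where "A = {\<omega> \<in> space P. J (Suc k) \<omega> = J k \<omega> @ [i]}"
  note [measurable] = spine_measurable V
  have [measurable]: "J k \<in> measurable ?F (count_space UNIV)"
    by (rule measurable_spine_past) simp
  have [measurable]: "\<psi> v \<in> measurable ?F mark_space" by (rule measurable_mark_past[OF v])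
  have A [measurable]: "A \<in> sets P" unfolding A_def by measurable
  interpret S: sigma_finite_subalgebra P ?F by (rule sigma_finite_spine_past)
  note [measurable] = pred_mark_offspring
  \<comment> \<open>The transition law is silent about \<open>i > N\<close>. The extra indicator of \<open>i \<le> N\<close> costs nothing on the
    left-hand side, as the spine only moves to actual children.\<close>
  define V' where "V' \<omega> = V \<omega> * total_factor \<alpha> (\<psi> v \<omega>) *
    (if J k \<omega> = v \<and> enat i \<le> fst (\<psi> v \<omega>) then 1 else 0)" for \<omega>
  have V' [measurable]: "V' \<in> borel_measurable ?F" unfolding V'_def by measurable
  have "(\<integral>\<^sup>+\<omega>. V \<omega> * total_factor \<alpha> (\<psi> v \<omega>) * indicator {\<omega>. J (Suc k) \<omega> = v @ [i]} \<omega> \<partial>P) =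
      (\<integral>\<^sup>+\<omega>. V' \<omega> * ennreal (indicat_real A \<omega>) \<partial>P)"
  proof (intro nn_integral_cong)
    fix \<omega> assume w: "\<omega> \<in> space P"
    have "J (Suc k) \<omega> = v @ [i] \<longleftrightarrow> J k \<omega> = v \<and> enat i \<le> fst (\<psi> v \<omega>) \<and> \<omega> \<in> A"
      using spine_child[OF w, of k] w by (auto simp: A_def offspring_def)
    then show "V \<omega> * total_factor \<alpha> (\<psi> v \<omega>) * indicator {\<omega>. J (Suc k) \<omega> = v @ [i]} \<omega> =
        V' \<omega> * ennreal (indicat_real A \<omega>)"
      by (auto simp: V'_def split: split_indicator)
  qed
  also have "\<dots> = (\<integral>\<^sup>+\<omega>. V' \<omega> * nn_cond_exp P ?F (\<lambda>\<omega>. ennreal (indicat_real A \<omega>)) \<omega> \<partial>P)"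
    by (rule S.nn_cond_exp_intg[symmetric]) measurable
  also have "\<dots> = (\<integral>\<^sup>+\<omega>. V \<omega> * child_factor \<alpha> (\<psi> v \<omega>) i * indicator {\<omega>. J k \<omega> = v} \<omega> \<partial>P)"
  proof (rule nn_integral_cong_AE)
    show "AE \<omega> in P. V' \<omega> * nn_cond_exp P ?F (\<lambda>\<omega>. ennreal (indicat_real A \<omega>)) \<omega> =
        V \<omega> * child_factor \<alpha> (\<psi> v \<omega>) i * indicator {\<omega>. J k \<omega> = v} \<omega>"
      using spine_transition[OF i, of k] nn_cond_exp_indicator[OF A, of k]
        AE_total_factor_finite[OF fin v]
    proof eventually_elim
      case (elim \<omega>)
      show ?case
      proof (cases "J k \<omega> = v \<and> enat i \<le> fst (\<psi> v \<omega>)")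
        case False
        then show ?thesis by (auto simp: V'_def child_factor_def)
      next
        case True
        let ?D = "total_factor \<alpha> (\<psi> v \<omega>)"
        show ?thesis
        proof (cases "?D = 0")
          case True
          then have "child_factor \<alpha> (\<psi> v \<omega>) i = 0"
            using child_factor_le_total_factor[OF i, of \<alpha> "\<psi> v \<omega>"] by simp
          then show ?thesis using True by (simp add: V'_def)
        next
          case False
          let ?c = "snd (snd (\<psi> v \<omega>)) i powr \<alpha>"
          obtain d where d: "?D = ennreal d" "d > 0"
            using False elim(3) by (cases ?D) auto
          have "real_cond_exp P ?F (indicat_real A) \<omega> = ?c / d"
            using elim(1) True False d
            by (simp add: weight_sum_eq_total_factor offspring_def weight_def A_def)
          then have "?D * nn_cond_exp P ?F (\<lambda>\<omega>. ennreal (indicat_real A \<omega>)) \<omega> = ennreal ?c"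
            using elim(2) d by (simp add: ennreal_mult[symmetric])
          then show ?thesis using True
            by (simp add: V'_def child_factor_def mult.assoc)
        qed
      qed
    qed
  qed
  finally show ?thesis .
qed

text \<open>One factor \<open>D\<close> is cancelled per step. The last step is removed first: the remaining factors are
  measurable with respect to its past, and the weight it leaves behind depends on marks only, so that
  it can be absorbed into \<open>W\<close>.\<close>

lemma nn_integral_spine_path:
  assumes fin: "(\<integral>\<^sup>+m. total_factor \<alpha> m \<partial>law) < \<infinity>"
    and "v \<in> individuals" and "W \<in> borel_measurable (spine_past P \<psi> J 0)"
  shows "(\<integral>\<^sup>+\<omega>. (\<Prod>s<length v. total_factor \<alpha> (\<psi> (take s v) \<omega>)) * W \<omega> *
      indicator {\<omega>. J (length v) \<omega> = v} \<omega> \<partial>P) =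
    (\<integral>\<^sup>+\<omega>. (\<Prod>s<length v. child_factor \<alpha> (\<psi> (take s v) \<omega>) (v ! s)) * W \<omega> \<partial>P)"
  using assms(2,3)
proof (induction v arbitrary: W rule: rev_induct)
  case Nil
  have "(\<integral>\<^sup>+\<omega>. W \<omega> * indicator {\<omega>. J 0 \<omega> = []} \<omega> \<partial>P) = (\<integral>\<^sup>+\<omega>. W \<omega> \<partial>P)"
    by (intro nn_integral_cong) (simp add: spine_root)
  then show ?case by simp
next
  case (snoc i v)
  let ?k = "length v"
  have v: "v \<in> individuals" and i: "i \<ge> 1" using snoc.prems by auto
  have mk: "(\<lambda>\<omega>. total_factor \<alpha> (\<psi> (take s v) \<omega>)) \<in> borel_measurable (spine_past P \<psi> J k)" for s k
    by (intro measurable_compose[OF measurable_mark_past measurable_total_factor] take_individuals v)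
  have W: "W \<in> borel_measurable (spine_past P \<psi> J k)" for k
    by (rule spine_past_0_le) (rule snoc.prems)
  define V where "V \<omega> = (\<Prod>s<?k. total_factor \<alpha> (\<psi> (take s v) \<omega>)) * W \<omega>" for \<omega>
  have V: "V \<in> borel_measurable (spine_past P \<psi> J k)" for k
    unfolding V_def by (intro borel_measurable_times_ennreal borel_measurable_prod_ennreal mk W)
  have cW: "(\<lambda>\<omega>. child_factor \<alpha> (\<psi> v \<omega>) i * W \<omega>) \<in> borel_measurable (spine_past P \<psi> J 0)"
    by (intro borel_measurable_times_ennreal W
        measurable_compose[OF measurable_mark_past measurable_child_factor] v i)
  have "(\<integral>\<^sup>+\<omega>. (\<Prod>s<length (v @ [i]). total_factor \<alpha> (\<psi> (take s (v @ [i])) \<omega>)) * W \<omega> *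
        indicator {\<omega>. J (length (v @ [i])) \<omega> = v @ [i]} \<omega> \<partial>P) =
      (\<integral>\<^sup>+\<omega>. V \<omega> * total_factor \<alpha> (\<psi> v \<omega>) * indicator {\<omega>. J (Suc ?k) \<omega> = v @ [i]} \<omega> \<partial>P)"
    by (intro nn_integral_cong) (simp add: V_def mult_ac)
  also have "\<dots> = (\<integral>\<^sup>+\<omega>. V \<omega> * child_factor \<alpha> (\<psi> v \<omega>) i * indicator {\<omega>. J ?k \<omega> = v} \<omega> \<partial>P)"
    by (rule nn_integral_spine_step[OF fin v i V])
  also have "\<dots> = (\<integral>\<^sup>+\<omega>. (\<Prod>s<?k. total_factor \<alpha> (\<psi> (take s v) \<omega>)) *
      (child_factor \<alpha> (\<psi> v \<omega>) i * W \<omega>) * indicator {\<omega>. J ?k \<omega> = v} \<omega> \<partial>P)"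
    by (intro nn_integral_cong) (simp add: V_def mult_ac)
  also have "\<dots> = (\<integral>\<^sup>+\<omega>. (\<Prod>s<?k. child_factor \<alpha> (\<psi> (take s v) \<omega>) (v ! s)) *
      (child_factor \<alpha> (\<psi> v \<omega>) i * W \<omega>) \<partial>P)"
    by (rule snoc.IH[OF v cW])
  also have "\<dots> = (\<integral>\<^sup>+\<omega>. (\<Prod>s<length (v @ [i]). child_factor \<alpha> (\<psi> (take s (v @ [i])) \<omega>)
      ((v @ [i]) ! s)) * W \<omega> \<partial>P)"
    by (intro nn_integral_cong) (simp add: nth_append mult_ac)
  finally show ?case .
qed

end

section \<open>Summation over all paths\<close>

text \<open>If \<open>E D = 1\<close>, this is the expectation of \<open>f\<close> under the law that the change of measure gives to the pair consisting of the
  mark of an individual on the spine and the rank of its child on the spine.\<close>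

definition size_biased_mean :: "mark measure \<Rightarrow> real \<Rightarrow> (mark \<Rightarrow> nat \<Rightarrow> ennreal) \<Rightarrow> ennreal" where
  "size_biased_mean law \<alpha> f =
    (\<integral>\<^sup>+m. \<integral>\<^sup>+i. child_factor \<alpha> m i * f m i \<partial>count_space {1..} \<partial>law)"

text \<open>A product summed over all paths is the product of the sums over children; this turns independence
  along every single path into independence along the random one.\<close>

lemma nn_integral_individuals_of_length:
  fixes a :: "nat \<Rightarrow> nat \<Rightarrow> ennreal"
  shows "(\<integral>\<^sup>+v. (\<Prod>s<k. a s (v ! s)) \<partial>count_space {v \<in> individuals. length v = k}) =
    (\<Prod>s<k. \<integral>\<^sup>+i. a s i \<partial>count_space {1..})"
proof (induction k)
  case 0
  have "{v \<in> individuals. length v = 0} = {[]}" by (auto simp: individuals_def)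
  then show ?case by (simp add: nn_integral_count_space_finite)
next
  case (Suc k)
  let ?K = "\<lambda>k. {v \<in> individuals. length v = k}"
  have bij: "bij_betw (\<lambda>(v, i). v @ [i]) (?K k \<times> {1..}) (?K (Suc k))"
  proof (rule bij_betwI[where g = "\<lambda>v. (butlast v, last v)"])
    show "(\<lambda>v. (butlast v, last v)) \<in> ?K (Suc k) \<rightarrow> ?K k \<times> {1..}"
    proof
      fix v assume "v \<in> ?K (Suc k)"
      then show "(butlast v, last v) \<in> ?K k \<times> {1..}"
        by (cases v rule: rev_cases) auto
    qed
  qed (auto simp: snoc_eq_iff_butlast)
  interpret B: sigma_finite_measure "count_space {1::nat..}"
    by (rule sigma_finite_measure_count_space_countable) simp
  have pair: "count_space (?K k) \<Otimes>\<^sub>M count_space {1..} = count_space (?K k \<times> {1::nat..})"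
    by (rule pair_measure_countable) (auto intro: countableI_type)
  have "(\<integral>\<^sup>+v. (\<Prod>s<Suc k. a s (v ! s)) \<partial>count_space (?K (Suc k))) =
      (\<integral>\<^sup>+x. (\<Prod>s<Suc k. a s ((case x of (v, i) \<Rightarrow> v @ [i]) ! s)) \<partial>count_space (?K k \<times> {1..}))"
    by (rule nn_integral_bij_count_space[OF bij, symmetric])
  also have "\<dots> = (\<integral>\<^sup>+x. (\<Prod>s<k. a s (fst x ! s)) * a k (snd x) \<partial>count_space (?K k \<times> {1..}))"
    by (intro nn_integral_cong) (auto simp: nth_append)
  also have "\<dots> = (\<integral>\<^sup>+v. \<integral>\<^sup>+i. (\<Prod>s<k. a s (v ! s)) * a k i \<partial>count_space {1..} \<partial>count_space (?K k))"
    using B.nn_integral_fst[of "\<lambda>x. (\<Prod>s<k. a s (fst x ! s)) * a k (snd x)" "count_space (?K k)"]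
    unfolding pair by simp
  also have "\<dots> = (\<Prod>s<Suc k. \<integral>\<^sup>+i. a s i \<partial>count_space {1..})"
    by (simp add: nn_integral_cmult nn_integral_multc Suc.IH)
  finally show ?case .
qed

context spine begin

text \<open>Splitting according to the value \<open>v\<close> of \<open>J\<^sub>k\<close>, which determines \<open>J\<^sub>0, \<dots>, J\<^sub>k\<close>, reduces the left-hand
  side to integrals over fixed paths. The mark of \<open>J\<^sub>k\<close> itself is not biased by \<open>L\<^sub>k\<close>.\<close>

theorem nn_integral_along_spine:
  fixes f :: "nat \<Rightarrow> mark \<Rightarrow> nat \<Rightarrow> ennreal" and h :: "mark \<Rightarrow> ennreal"
  assumes fin: "(\<integral>\<^sup>+m. total_factor \<alpha> m \<partial>law) < \<infinity>"
    and f: "\<And>s i. i \<ge> 1 \<Longrightarrow> (\<lambda>m. f s m i) \<in> borel_measurable mark_space"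
    and h: "h \<in> borel_measurable mark_space"
  shows "(\<integral>\<^sup>+\<omega>. (\<Prod>s<k. f s (\<psi> (J s \<omega>) \<omega>) (last (J (Suc s) \<omega>))) * h (\<psi> (J k \<omega>) \<omega>) *
      spine_density \<alpha> \<psi> J k \<omega> \<partial>P) =
    (\<Prod>s<k. size_biased_mean law \<alpha> (f s)) * (\<integral>\<^sup>+m. h m \<partial>law)"
proof -
  let ?K = "{v \<in> individuals. length v = k}"
  \<comment> \<open>\<open>W v\<close> and \<open>D v\<close> are the test function and the density \<open>L\<^sub>k\<close> on the event \<open>J\<^sub>k = v\<close>.\<close>
  define W where "W v \<omega> = (\<Prod>s<k. f s (\<psi> (take s v) \<omega>) (v ! s)) * h (\<psi> v \<omega>)" for v \<omega>
  define D where "D v \<omega> = (\<Prod>s<k. total_factor \<alpha> (\<psi> (take s v) \<omega>))" for v \<omega>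
  have W: "W v \<in> borel_measurable (spine_past P \<psi> J 0)" if v: "v \<in> ?K" for v
    unfolding W_def using v
    by (intro borel_measurable_times_ennreal borel_measurable_prod_ennreal
        measurable_compose[OF measurable_mark_past f] measurable_compose[OF measurable_mark_past h])
      (use individuals_nth in auto)
  have D: "D v \<in> borel_measurable (spine_past P \<psi> J 0)" if v: "v \<in> ?K" for v
    unfolding D_def using v
    by (intro borel_measurable_prod_ennreal
        measurable_compose[OF measurable_mark_past measurable_total_factor]) auto
  have DWI: "(\<lambda>\<omega>. D v \<omega> * W v \<omega> * indicator {\<omega>. J k \<omega> = v} \<omega>) \<in> borel_measurable P"
    if v: "v \<in> ?K" for v
  proof -
    note [measurable] = spine_measurable measurable_from_subalg[OF subalgebra_spine_past W[OF v]]
      measurable_from_subalg[OF subalgebra_spine_past D[OF v]]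
    show ?thesis by measurable
  qed
  have "(\<integral>\<^sup>+\<omega>. (\<Prod>s<k. f s (\<psi> (J s \<omega>) \<omega>) (last (J (Suc s) \<omega>))) * h (\<psi> (J k \<omega>) \<omega>) *
      spine_density \<alpha> \<psi> J k \<omega> \<partial>P) =
    (\<integral>\<^sup>+\<omega>. \<integral>\<^sup>+v. D v \<omega> * W v \<omega> * indicator {\<omega>. J k \<omega> = v} \<omega> \<partial>count_space ?K \<partial>P)"
  proof (intro nn_integral_cong)
    fix \<omega> assume w: "\<omega> \<in> space P"
    let ?v = "J k \<omega>"
    have v: "?v \<in> ?K" using spine_length[OF w] spine_individual[OF w] by auto
    have "(\<integral>\<^sup>+v. D v \<omega> * W v \<omega> * indicator {\<omega>. J k \<omega> = v} \<omega> \<partial>count_space ?K) =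
        (\<integral>\<^sup>+v. D v \<omega> * W v \<omega> * indicator {?v} v \<partial>count_space ?K)"
      by (intro nn_integral_cong) (auto split: split_indicator)
    also have "\<dots> = D ?v \<omega> * W ?v \<omega>"
      using v by (subst nn_integral_indicator_singleton) auto
    also have "D ?v \<omega> = spine_density \<alpha> \<psi> J k \<omega>"
      by (simp add: D_def spine_density_def weight_sum_eq_total_factor spine_prefix[OF w])
    also have "W ?v \<omega> = (\<Prod>s<k. f s (\<psi> (J s \<omega>) \<omega>) (last (J (Suc s) \<omega>))) * h (\<psi> ?v \<omega>)"
      by (simp add: W_def spine_prefix[OF w] spine_last[OF w])
    finally show "(\<Prod>s<k. f s (\<psi> (J s \<omega>) \<omega>) (last (J (Suc s) \<omega>))) * h (\<psi> ?v \<omega>) *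
        spine_density \<alpha> \<psi> J k \<omega> =
        (\<integral>\<^sup>+v. D v \<omega> * W v \<omega> * indicator {\<omega>. J k \<omega> = v} \<omega> \<partial>count_space ?K)"
      by (simp add: mult_ac)
  qed
  also have "\<dots> = (\<integral>\<^sup>+v. \<integral>\<^sup>+\<omega>. D v \<omega> * W v \<omega> * indicator {\<omega>. J k \<omega> = v} \<omega> \<partial>P \<partial>count_space ?K)"
    by (intro nn_integral_count_space_nn_integral DWI) (auto intro: countableI_type)
  also have "\<dots> = (\<integral>\<^sup>+v. (\<Prod>s<k. \<integral>\<^sup>+m. child_factor \<alpha> m (v ! s) * f s m (v ! s) \<partial>law) *
      (\<integral>\<^sup>+m. h m \<partial>law) \<partial>count_space ?K)"
  proof (intro nn_integral_cong)
    fix v assume "v \<in> space (count_space ?K)"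
    then have K: "v \<in> ?K" and v: "v \<in> individuals" and k: "length v = k" by auto
    have "(\<integral>\<^sup>+\<omega>. D v \<omega> * W v \<omega> * indicator {\<omega>. J k \<omega> = v} \<omega> \<partial>P) =
        (\<integral>\<^sup>+\<omega>. (\<Prod>s<length v. child_factor \<alpha> (\<psi> (take s v) \<omega>) (v ! s)) * W v \<omega> \<partial>P)"
      using nn_integral_spine_path[OF fin v W[OF K]] by (simp add: D_def k)
    also have "\<dots> = (\<integral>\<^sup>+\<omega>. (\<Prod>s<length v. child_factor \<alpha> (\<psi> (take s v) \<omega>) (v ! s) *
        f s (\<psi> (take s v) \<omega>) (v ! s)) * h (\<psi> v \<omega>) \<partial>P)"
      by (simp add: W_def k prod.distrib mult.assoc)
    also have "\<dots> = (\<Prod>s<length v. \<integral>\<^sup>+m. child_factor \<alpha> m (v ! s) * f s m (v ! s) \<partial>law) *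
        (\<integral>\<^sup>+m. h m \<partial>law)"
      by (rule nn_integral_marks_along_path[OF v _ h])
        (intro borel_measurable_times_ennreal measurable_child_factor f individuals_nth v)
    finally show "(\<integral>\<^sup>+\<omega>. D v \<omega> * W v \<omega> * indicator {\<omega>. J k \<omega> = v} \<omega> \<partial>P) =
        (\<Prod>s<k. \<integral>\<^sup>+m. child_factor \<alpha> m (v ! s) * f s m (v ! s) \<partial>law) * (\<integral>\<^sup>+m. h m \<partial>law)"
      by (simp add: k)
  qed
  also have "\<dots> = (\<Prod>s<k. \<integral>\<^sup>+i. \<integral>\<^sup>+m. child_factor \<alpha> m i * f s m i \<partial>law \<partial>count_space {1..}) *
      (\<integral>\<^sup>+m. h m \<partial>law)"
    by (simp add: nn_integral_multc
        nn_integral_individuals_of_length[of k "\<lambda>s i. \<integral>\<^sup>+m. child_factor \<alpha> m i * f s m i \<partial>law"])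
  also have "\<dots> = (\<Prod>s<k. size_biased_mean law \<alpha> (f s)) * (\<integral>\<^sup>+m. h m \<partial>law)"
  proof -
    have "(\<integral>\<^sup>+i. \<integral>\<^sup>+m. child_factor \<alpha> m i * f s m i \<partial>law \<partial>count_space {1..}) =
        size_biased_mean law \<alpha> (f s)" for s
      unfolding size_biased_mean_def
      by (rule nn_integral_count_space_nn_integral[symmetric])
        (auto intro!: borel_measurable_times_ennreal measurable_child_factor f
          simp: measurable_cong_sets[OF sets_law refl])
    then show ?thesis by simp
  qed
  finally show ?thesis .
qed

end

section \<open>The filtration and the tilted measure\<close>

context spine begin

lemma generation_measurable:
  "v \<in> individuals \<Longrightarrow> {\<omega> \<in> space P. v \<in> generation \<psi> s \<omega>} \<in> sets P"
proof (induction s arbitrary: v)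
  case (Suc s)
  show ?case
  proof (cases v rule: rev_cases)
    case Nil
    then show ?thesis by simp
  next
    case (snoc w j)
    then have w: "w \<in> individuals" "j \<ge> 1" using Suc.prems by auto
    note [measurable] = Suc.IH[OF w(1)] measurable_compose[OF measurable_mark[OF w(1)] pred_mark_offspring]
    have "{\<omega> \<in> space P. v \<in> generation \<psi> (Suc s) \<omega>} =
        {\<omega> \<in> space P. w \<in> generation \<psi> s \<omega>} \<inter> {\<omega> \<in> space P. enat j \<le> fst (\<psi> w \<omega>)}"
      using w snoc by (auto simp: offspring_def)
    also have "\<dots> \<in> sets P" by measurable
    finally show ?thesis .
  qed
qed simp

lemma spine_in_generation: "\<omega> \<in> space P \<Longrightarrow> J k \<omega> \<in> generation \<psi> k \<omega>"
proof (induction k)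
  case (Suc k)
  then show ?case using spine_child[of \<omega> k] by auto
qed (simp add: spine_root)

lemma space_spine_filtration [simp]: "space (spine_filtration P \<psi> J k) = space P"
  unfolding spine_filtration_def tree_events_def by (intro space_measure_of) auto

lemma sets_spine_filtration: "sets (spine_filtration P \<psi> J k) = sigma_sets (space P)
     (tree_events P \<psi> k \<union> {J s -` {v} \<inter> space P | s v. s \<le> k})"
  unfolding spine_filtration_def tree_events_def by (intro sets_measure_of) auto

lemma subalgebra_spine_filtration: "subalgebra P (spine_filtration P \<psi> J k)"
proof -
  have "{\<omega> \<in> space P. v \<in> generation \<psi> s \<omega> \<and> \<psi> v \<omega> \<in> B} \<in> sets P"
    if "v \<in> individuals" "B \<in> sets mark_space" for v s B
  proof -
    have "{\<omega> \<in> space P. v \<in> generation \<psi> s \<omega> \<and> \<psi> v \<omega> \<in> B} =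
        {\<omega> \<in> space P. v \<in> generation \<psi> s \<omega>} \<inter> (\<psi> v -` B \<inter> space P)" by auto
    also have "\<dots> \<in> sets P"
      by (intro sets.Int generation_measurable measurable_sets[OF measurable_mark] that)
    finally show ?thesis .
  qed
  then have "sets (spine_filtration P \<psi> J k) \<subseteq> sets P"
    unfolding sets_spine_filtration
    by (intro sets.sigma_sets_subset)
       (auto simp: tree_events_def intro!: measurable_sets[OF spine_measurable])
  then show ?thesis by (simp add: subalgebra_def)
qed

lemma measurable_spine_filtration:
  "s \<le> k \<Longrightarrow> J s \<in> measurable (spine_filtration P \<psi> J k) (count_space UNIV)"
  by (subst measurable_count_space_eq2_countable)
     (auto simp: sets_spine_filtration intro!: sigma_sets.Basic)

text \<open>Because \<open>J\<^sub>s\<close> surely lies in generation \<open>s\<close>, the generators of \<open>F\<^sub>k\<close>, which only reveal the marks of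
  individuals that are born, determine the mark of \<open>J\<^sub>s\<close>.\<close>

lemma measurable_spine_mark:
  assumes "s < k"
  shows "(\<lambda>\<omega>. \<psi> (J s \<omega>) \<omega>) \<in> measurable (spine_filtration P \<psi> J k) mark_space"
proof (rule measurableI)
  fix \<omega> assume "\<omega> \<in> space (spine_filtration P \<psi> J k)"
  then show "\<psi> (J s \<omega>) \<omega> \<in> space mark_space"
    using measurable_space[OF measurable_mark[OF spine_individual]] by simp
next
  fix B assume B: "B \<in> sets mark_space"
  let ?G = "spine_filtration P \<psi> J k"
  have eq: "(\<lambda>\<omega>. \<psi> (J s \<omega>) \<omega>) -` B \<inter> space ?G = (\<Union>v\<in>individuals.
      (J s -` {v} \<inter> space P) \<inter> {\<omega> \<in> space P. v \<in> generation \<psi> s \<omega> \<and> \<psi> v \<omega> \<in> B})"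
    using spine_individual spine_in_generation by auto
  show "(\<lambda>\<omega>. \<psi> (J s \<omega>) \<omega>) -` B \<inter> space ?G \<in> sets ?G"
    unfolding eq
  proof (rule sets.countable_UN''[OF countable_individuals], rule sets.Int)
    fix v assume v: "v \<in> individuals"
    show "J s -` {v} \<inter> space P \<in> sets ?G"
      using measurable_sets[OF measurable_spine_filtration[of s k], of "{v}"] assms by simp
    show "{\<omega> \<in> space P. v \<in> generation \<psi> s \<omega> \<and> \<psi> v \<omega> \<in> B} \<in> sets ?G"
      unfolding sets_spine_filtration tree_events_def
      using v B assms by (intro sigma_sets.Basic) blast
  qed
qed

lemma measurable_spine_transition:
  fixes f :: "mark \<Rightarrow> nat \<Rightarrow> 'c::topological_space"
  assumes s: "s < k" and f: "\<And>i. i \<ge> 1 \<Longrightarrow> (\<lambda>m. f m i) \<in> borel_measurable mark_space"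
  shows "(\<lambda>\<omega>. f (\<psi> (J s \<omega>) \<omega>) (last (J (Suc s) \<omega>))) \<in> borel_measurable (spine_filtration P \<psi> J k)"
proof (rule measurable_compose_countable'[where I = "{1..}"])
  show "(\<lambda>\<omega>. f (\<psi> (J s \<omega>) \<omega>) i) \<in> borel_measurable (spine_filtration P \<psi> J k)" if "i \<in> {1..}" for i
    using that by (intro measurable_compose[OF measurable_spine_mark[OF s] f]) simp
  have "(\<lambda>\<omega>. last (J (Suc s) \<omega>)) \<in> measurable (spine_filtration P \<psi> J k) (count_space UNIV)"
    by (rule measurable_compose[OF measurable_spine_filtration]) (use s in auto)
  then show "(\<lambda>\<omega>. last (J (Suc s) \<omega>)) \<in> measurable (spine_filtration P \<psi> J k) (count_space {1..})"
    using spine_last_ge_1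
    by (subst measurable_count_space_eq2_countable) (auto simp: measurable_count_space_eq2_countable)
qed simp

lemma measurable_spine_density:
  "spine_density \<alpha> \<psi> J k \<in> borel_measurable (spine_filtration P \<psi> J k)"
  unfolding spine_density_def weight_sum_eq_total_factor
  by (intro borel_measurable_prod_ennreal measurable_compose[OF measurable_spine_mark])
    auto

end

context spine_change_of_measure begin

lemma subalgebra_tilted: "subalgebra Pt (spine_filtration P \<psi> J k)"
  unfolding subalgebra_def tilted_space tilted_sets by auto

text \<open>\<open>Pt\<close> and the measure with \<open>P\<close>-density \<open>L\<^sub>k\<close> agree on the sub-\<open>\<sigma>\<close>-algebra \<open>G\<^sub>k\<close>.\<close>

lemma nn_integral_tilted:
  assumes F: "F \<in> borel_measurable (spine_filtration P \<psi> J k)"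
  shows "(\<integral>\<^sup>+\<omega>. F \<omega> \<partial>Pt) = (\<integral>\<^sup>+\<omega>. F \<omega> * spine_density \<alpha> \<psi> J k \<omega> \<partial>P)"
proof -
  let ?G = "spine_filtration P \<psi> J k" and ?L = "spine_density \<alpha> \<psi> J k"
  have L: "?L \<in> borel_measurable P"
    by (rule measurable_from_subalg[OF subalgebra_spine_filtration measurable_spine_density])
  have FP: "F \<in> borel_measurable P"
    by (rule measurable_from_subalg[OF subalgebra_spine_filtration F])
  have sub: "subalgebra (density P ?L) ?G"
    using subalgebra_spine_filtration by (simp add: subalgebra_def)
  have "restr_to_subalg Pt ?G = restr_to_subalg (density P ?L) ?G"
  proof (rule measure_eqI)
    fix A assume "A \<in> sets (restr_to_subalg Pt ?G)"
    then have A: "A \<in> sets ?G" by (simp add: sets_restr_to_subalg[OF subalgebra_tilted])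
    then have "A \<in> sets P" using subalgebra_spine_filtration by (auto simp: subalgebra_def)
    then show "emeasure (restr_to_subalg Pt ?G) A = emeasure (restr_to_subalg (density P ?L) ?G) A"
      using A by (simp add: emeasure_restr_to_subalg subalgebra_tilted sub emeasure_density L
          tilted_emeasure mult.commute)
  qed (simp add: sets_restr_to_subalg subalgebra_tilted sub)
  then have "(\<integral>\<^sup>+\<omega>. F \<omega> \<partial>Pt) = (\<integral>\<^sup>+\<omega>. F \<omega> \<partial>density P ?L)"
    using nn_integral_subalgebra2[OF subalgebra_tilted F] nn_integral_subalgebra2[OF sub F] by simp
  also have "\<dots> = (\<integral>\<^sup>+\<omega>. F \<omega> * ?L \<omega> \<partial>P)"
    by (simp add: nn_integral_density L FP mult.commute)
  finally show ?thesis .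
qed

text \<open>The integrand involves the mark of \<open>J\<^sub>k\<close>, which is revealed only by \<open>G\<^bsub>k+1\<^esub>\<close>. The density is
  therefore \<open>L\<^bsub>k+1\<^esub> = L\<^sub>k D\<^bsub>J\<^sub>k\<^esub>\<close>, and its last factor biases that mark.\<close>

theorem nn_integral_tilted_spine:
  fixes f :: "nat \<Rightarrow> mark \<Rightarrow> nat \<Rightarrow> ennreal" and h :: "mark \<Rightarrow> ennreal"
  assumes fin: "(\<integral>\<^sup>+m. total_factor \<alpha> m \<partial>law) < \<infinity>"
    and f: "\<And>s i. i \<ge> 1 \<Longrightarrow> (\<lambda>m. f s m i) \<in> borel_measurable mark_space"
    and h: "h \<in> borel_measurable mark_space"
  shows "(\<integral>\<^sup>+\<omega>. (\<Prod>s<k. f s (\<psi> (J s \<omega>) \<omega>) (last (J (Suc s) \<omega>))) * h (\<psi> (J k \<omega>) \<omega>) \<partial>Pt) =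
    (\<Prod>s<k. size_biased_mean law \<alpha> (f s)) * (\<integral>\<^sup>+m. h m * total_factor \<alpha> m \<partial>law)"
proof -
  have "(\<lambda>\<omega>. (\<Prod>s<k. f s (\<psi> (J s \<omega>) \<omega>) (last (J (Suc s) \<omega>))) * h (\<psi> (J k \<omega>) \<omega>))
      \<in> borel_measurable (spine_filtration P \<psi> J (Suc k))"
    by (intro borel_measurable_times_ennreal borel_measurable_prod_ennreal
        measurable_spine_transition f measurable_compose[OF measurable_spine_mark h]) auto
  from nn_integral_tilted[OF this]
  have "(\<integral>\<^sup>+\<omega>. (\<Prod>s<k. f s (\<psi> (J s \<omega>) \<omega>) (last (J (Suc s) \<omega>))) * h (\<psi> (J k \<omega>) \<omega>) \<partial>Pt) =
    (\<integral>\<^sup>+\<omega>. (\<Prod>s<k. f s (\<psi> (J s \<omega>) \<omega>) (last (J (Suc s) \<omega>))) *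
      (h (\<psi> (J k \<omega>) \<omega>) * total_factor \<alpha> (\<psi> (J k \<omega>) \<omega>)) * spine_density \<alpha> \<psi> J k \<omega> \<partial>P)"
    by (simp add: spine_density_def weight_sum_eq_total_factor mult_ac)
  also have "\<dots> = (\<Prod>s<k. size_biased_mean law \<alpha> (f s)) * (\<integral>\<^sup>+m. h m * total_factor \<alpha> m \<partial>law)"
    using h by (intro nn_integral_along_spine[OF fin f]) auto
  finally show ?thesis .
qed

end

section \<open>The increments along the spine\<close>

lemma elog_le_iff: "c \<ge> 0 \<Longrightarrow> elog c \<le> x \<longleftrightarrow> ereal c \<le> eexp x"
  by (cases x) (auto simp: elog_def eexp_def, (metis exp_le_cancel_iff exp_ln order_le_less)+)

lemma measurable_elog [measurable]: "elog \<in> borel_measurable borel"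
  unfolding elog_def by measurable

text \<open>Expectations under the tilted measure are computed for nonnegative functions; this decomposition
  transfers them to the signed series that defines the mean.\<close>

lemma esum_real_eq_diff:
  fixes f :: "nat \<Rightarrow> real"
  assumes "esum n (\<lambda>i. ennreal \<bar>f i\<bar>) < \<infinity>"
  shows "esum n f = enn2real (esum n (\<lambda>i. ennreal (f i))) - enn2real (esum n (\<lambda>i. ennreal (- f i)))"
proof -
  define g where "g i = (if enat (Suc i) \<le> n then f (Suc i) else 0)" for i
  have "(\<Sum>i. ennreal \<bar>g i\<bar>) = esum n (\<lambda>i. ennreal \<bar>f i\<bar>)"
    unfolding esum_def by (intro suminf_cong) (simp add: g_def)
  then have abs: "summable (\<lambda>i. \<bar>g i\<bar>)"
    using assms by (intro summable_suminf_not_top) auto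
  have pos: "summable (\<lambda>i. max (g i) 0)" and neg: "summable (\<lambda>i. max (- g i) 0)"
    by (rule summable_comparison_test'[OF abs, of 0], simp)+
  have P: "esum n (\<lambda>i. ennreal (f i)) = ennreal (\<Sum>i. max (g i) 0)"
    unfolding esum_def
    by (subst suminf_ennreal2[OF _ pos, symmetric]) (auto simp: g_def intro!: suminf_cong)
  have N: "esum n (\<lambda>i. ennreal (- f i)) = ennreal (\<Sum>i. max (- g i) 0)"
    unfolding esum_def
    by (subst suminf_ennreal2[OF _ neg, symmetric]) (auto simp: g_def intro!: suminf_cong)
  have "esum n f = (\<Sum>i. max (g i) 0 - max (- g i) 0)"
    unfolding esum_def by (intro suminf_cong) (auto simp: g_def)
  also have "\<dots> = (\<Sum>i. max (g i) 0) - (\<Sum>i. max (- g i) 0)"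
    by (rule suminf_diff[OF pos neg, symmetric])
  finally show ?thesis
    unfolding P N by (simp add: suminf_nonneg pos neg)
qed

context spine_change_of_measure begin

text \<open>If \<open>E D = 1\<close>, this is the expectation of \<open>\<phi>\<close> under the law with distribution function \<open>G\<close>.\<close>

definition step_mean :: "(ereal \<Rightarrow> ennreal) \<Rightarrow> ennreal" where
  "step_mean \<phi> = size_biased_mean law \<alpha> (\<lambda>m i. \<phi> (elog (snd (snd m) i)))"

lemma spine_step_Suc:
  assumes "\<omega> \<in> space P"
  shows "spine_step \<psi> J (Suc s) \<omega> = elog (snd (snd (\<psi> (J s \<omega>) \<omega>)) (last (J (Suc s) \<omega>)))"
proof -
  have "butlast (J (Suc s) \<omega>) = J s \<omega>"
    by (subst spine_snoc[OF assms]) simp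
  then show ?thesis by (simp add: spine_step_def weight_def)
qed

lemma measurable_elog_mark_weight:
  "i \<ge> 1 \<Longrightarrow> (\<lambda>m. elog (snd (snd m) i)) \<in> borel_measurable mark_space"
  by (rule measurable_compose[OF measurable_mark_weight measurable_elog])

lemma measurable_spine_step: "r \<ge> 1 \<Longrightarrow> spine_step \<psi> J r \<in> borel_measurable Pt"
proof -
  assume "r \<ge> 1"
  then obtain s where s: "r = Suc s" by (cases r) auto
  have "(\<lambda>\<omega>. elog (snd (snd (\<psi> (J s \<omega>) \<omega>)) (last (J (Suc s) \<omega>)))) \<in> borel_measurable Pt"
    by (rule measurable_from_subalg[OF subalgebra_tilted[of r]],
        rule measurable_spine_transition[where f = "\<lambda>m i. elog (snd (snd m) i)"])
      (simp_all add: s measurable_elog_mark_weight)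
  then show ?thesis
    by (subst measurable_cong[OF spine_step_Suc[of _ s, folded s]]) (simp_all add: tilted_space s)
qed

lemma measurable_mark_along_spine: "(\<lambda>\<omega>. \<psi> (J k \<omega>) \<omega>) \<in> measurable Pt mark_space"
  by (rule measurable_from_subalg[OF subalgebra_tilted[of "Suc k"] measurable_spine_mark]) simp

theorem nn_integral_spine_steps:
  fixes \<phi> :: "nat \<Rightarrow> ereal \<Rightarrow> ennreal" and h :: "mark \<Rightarrow> ennreal"
  assumes fin: "(\<integral>\<^sup>+m. total_factor \<alpha> m \<partial>law) < \<infinity>"
    and \<phi>: "\<And>r. \<phi> r \<in> borel_measurable borel"
    and h: "h \<in> borel_measurable mark_space"
  shows "(\<integral>\<^sup>+\<omega>. (\<Prod>r=1..k. \<phi> r (spine_step \<psi> J r \<omega>)) * h (\<psi> (J k \<omega>) \<omega>) \<partial>Pt) =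
    (\<Prod>r=1..k. step_mean (\<phi> r)) * (\<integral>\<^sup>+m. h m * total_factor \<alpha> m \<partial>law)"
proof -
  have "(\<integral>\<^sup>+\<omega>. (\<Prod>r=1..k. \<phi> r (spine_step \<psi> J r \<omega>)) * h (\<psi> (J k \<omega>) \<omega>) \<partial>Pt) =
    (\<integral>\<^sup>+\<omega>. (\<Prod>s<k. \<phi> (Suc s) (elog (snd (snd (\<psi> (J s \<omega>) \<omega>)) (last (J (Suc s) \<omega>))))) *
      h (\<psi> (J k \<omega>) \<omega>) \<partial>Pt)"
    by (intro nn_integral_cong) (simp add: tilted_space spine_step_Suc prod.atLeast1_atMost_eq)
  also have "\<dots> = (\<Prod>s<k. step_mean (\<phi> (Suc s))) * (\<integral>\<^sup>+m. h m * total_factor \<alpha> m \<partial>law)"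
    unfolding step_mean_def
    by (rule nn_integral_tilted_spine[OF fin _ h, where f = "\<lambda>s m i. \<phi> (Suc s) (elog (snd (snd m) i))"])
      (rule measurable_compose[OF measurable_elog_mark_weight \<phi>])
  finally show ?thesis by (simp add: prod.atLeast1_atMost_eq)
qed

lemma step_mean_1: "step_mean (\<lambda>_. 1) = (\<integral>\<^sup>+m. total_factor \<alpha> m \<partial>law)"
  by (simp add: step_mean_def size_biased_mean_def total_factor_def)

text \<open>In the product formula every factor other than the \<open>i\<close>-th is taken to be \<open>1\<close>, whose \<open>step_mean\<close>
  is \<open>E D = 1\<close>.\<close>

lemma nn_integral_spine_step_marginal:
  assumes one: "(\<integral>\<^sup>+m. total_factor \<alpha> m \<partial>law) = 1"
    and \<phi>: "\<phi> \<in> borel_measurable borel" and i: "i \<ge> 1"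
  shows "(\<integral>\<^sup>+\<omega>. \<phi> (spine_step \<psi> J i \<omega>) \<partial>Pt) = step_mean \<phi>"
proof -
  define \<phi>' where "\<phi>' r = (if r = i then \<phi> else (\<lambda>_. 1))" for r
  have eq: "(\<Prod>r=1..i. F (\<phi>' r) r) = F \<phi> i" if "\<And>r. F (\<lambda>_. 1) r = 1" for F :: "_ \<Rightarrow> _ \<Rightarrow> ennreal"
  proof -
    have "(\<Prod>r=1..i. F (\<phi>' r) r) = (\<Prod>r\<in>{i}. F (\<phi>' r) r)"
      by (rule prod.mono_neutral_right) (use i that in \<open>auto simp: \<phi>'_def\<close>)
    then show ?thesis by (simp add: \<phi>'_def)
  qed
  have "(\<integral>\<^sup>+\<omega>. (\<Prod>r=1..i. \<phi>' r (spine_step \<psi> J r \<omega>)) * 1 \<partial>Pt) = (\<Prod>r=1..i. step_mean (\<phi>' r)) * 1"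
    using one \<phi> nn_integral_spine_steps[of \<phi>' "\<lambda>_. 1" i] by (simp add: \<phi>'_def)
  moreover have "(\<Prod>r=1..i. step_mean (\<phi>' r)) = step_mean \<phi>"
    by (rule eq) (simp add: step_mean_1 one)
  moreover have "(\<Prod>r=1..i. \<phi>' r (spine_step \<psi> J r \<omega>)) = \<phi> (spine_step \<psi> J i \<omega>)" for \<omega>
    by (rule eq[of "\<lambda>\<phi> r. \<phi> (spine_step \<psi> J r \<omega>)"]) simp
  ultimately show ?thesis by simp
qed

text \<open>Any finite set of indices lies in some \<open>{1..k}\<close>, and indices outside it are filled up with the sure
  event.\<close>

theorem indep_vars_spine_step:
  assumes one: "(\<integral>\<^sup>+m. total_factor \<alpha> m \<partial>law) = 1"
  shows "tilted.indep_vars (\<lambda>_. borel) (spine_step \<psi> J) {1..}"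
  unfolding tilted.indep_vars_def2 tilted.indep_sets_def
proof (intro conjI ballI allI impI)
  show X: "spine_step \<psi> J i \<in> borel_measurable Pt" if "i \<in> {1..}" for i
    using that measurable_spine_step by simp
  show "{spine_step \<psi> J i -` A \<inter> space Pt |A. A \<in> sets borel} \<subseteq> tilted.events" if "i \<in> {1..}" for i
    using X[OF that] by (auto intro: measurable_sets)
  fix I :: "nat set" and A
  assume I: "I \<subseteq> {1..}" "I \<noteq> {}" "finite I"
    and A: "A \<in> Pi I (\<lambda>i. {spine_step \<psi> J i -` A \<inter> space Pt |A. A \<in> sets borel})"
  then obtain B where B: "\<And>i. i \<in> I \<Longrightarrow> B i \<in> sets borel"
    "\<And>i. i \<in> I \<Longrightarrow> A i = spine_step \<psi> J i -` B i \<inter> space Pt"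
    by (auto simp: Pi_iff) metis
  define B' where "B' i = (if i \<in> I then B i else UNIV)" for i
  have B'm [measurable]: "B' i \<in> sets borel" for i using B(1) by (simp add: B'_def)
  have Am: "A i \<in> sets Pt" if "i \<in> I" for i
    using B[OF that] X[of i] that I(1) by (auto intro: measurable_sets)
  let ?k = "Max I"
  have Ik: "I \<subseteq> {1..?k}" using I by auto
  have marg: "emeasure Pt (A i) = step_mean (indicator (B i))" if "i \<in> I" for i
  proof -
    have "emeasure Pt (A i) = (\<integral>\<^sup>+\<omega>. indicator (A i) \<omega> \<partial>Pt)"
      using Am[OF that] by simp
    also have "\<dots> = (\<integral>\<^sup>+\<omega>. indicator (B i) (spine_step \<psi> J i \<omega>) \<partial>Pt)"
      by (intro nn_integral_cong) (auto simp: B(2)[OF that] split: split_indicator)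
    also have "\<dots> = step_mean (indicator (B i))"
      using B(1)[OF that] that I(1) by (intro nn_integral_spine_step_marginal[OF one]) auto
    finally show ?thesis .
  qed
  have "emeasure Pt (\<Inter>i\<in>I. A i) = (\<integral>\<^sup>+\<omega>. indicator (\<Inter>i\<in>I. A i) \<omega> \<partial>Pt)"
    using I Am by (simp add: sets.finite_INT)
  also have "\<dots> = (\<integral>\<^sup>+\<omega>. (\<Prod>r=1..?k. indicator (B' r) (spine_step \<psi> J r \<omega>)) * 1 \<partial>Pt)"
  proof (intro nn_integral_cong)
    fix \<omega> assume w: "\<omega> \<in> space Pt"
    have "(\<Prod>r=1..?k. indicator (B' r) (spine_step \<psi> J r \<omega>)) =
        (\<Prod>r\<in>I. indicator (B' r) (spine_step \<psi> J r \<omega>) :: ennreal)"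
      by (rule prod.mono_neutral_right) (use Ik in \<open>auto simp: B'_def\<close>)
    also have "\<dots> = (\<Prod>r\<in>I. indicator (A r) \<omega>)"
      using w B(2) by (intro prod.cong) (auto simp: B'_def split: split_indicator)
    also have "\<dots> = indicator (\<Inter>i\<in>I. A i) \<omega>"
      using I(3) by (induction rule: finite_induct) (auto simp: indicator_inter_arith)
    finally show "indicator (\<Inter>i\<in>I. A i) \<omega> =
        (\<Prod>r=1..?k. indicator (B' r) (spine_step \<psi> J r \<omega>)) * (1::ennreal)" by simp
  qed
  also have "\<dots> = (\<Prod>r=1..?k. step_mean (indicator (B' r)))"
    using one nn_integral_spine_steps[of "\<lambda>r. indicator (B' r)" "\<lambda>_. 1" ?k] by simp
  also have "\<dots> = (\<Prod>r\<in>I. step_mean (indicator (B' r)))"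
    by (rule prod.mono_neutral_right) (use Ik in \<open>auto simp: B'_def step_mean_1 one\<close>)
  also have "\<dots> = (\<Prod>r\<in>I. emeasure Pt (A r))"
    by (intro prod.cong) (auto simp: B'_def marg)
  finally have "ennreal (measure Pt (\<Inter>i\<in>I. A i)) = ennreal (\<Prod>r\<in>I. measure Pt (A r))"
    by (simp add: tilted.emeasure_eq_measure prod_ennreal)
  then show "measure Pt (\<Inter>i\<in>I. A i) = (\<Prod>r\<in>I. measure Pt (A r))"
    by (simp add: prod_nonneg)
qed

end

section \<open>Expressing the laws by the generic vector\<close>

text \<open>A vector with the common law of the marks, on a space of its own.\<close>

locale mark_vector_variable =
  fixes R :: "'b measure" and N :: "'b \<Rightarrow> enat" and Q :: "'b \<Rightarrow> real" and C :: "nat \<Rightarrow> 'b \<Rightarrow> real"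
  assumes mark_vector_measurable: "mark_vector N Q C \<in> measurable R mark_space"
begin

lemma measurable_offspring: "Measurable.pred R (\<lambda>\<omega>. enat i \<le> N \<omega>)"
  using measurable_compose[OF mark_vector_measurable pred_mark_offspring[of i]]
  by (simp add: mark_vector_def)

lemma measurable_toll [measurable]: "Q \<in> borel_measurable R"
  using measurable_compose[OF mark_vector_measurable measurable_mark_toll]
  by (simp add: mark_vector_def)

lemma measurable_weight: "i \<ge> 1 \<Longrightarrow> C i \<in> borel_measurable R"
  using measurable_compose[OF mark_vector_measurable measurable_mark_weight[of i]]
  by (simp add: mark_vector_def)

lemma weight_nonneg: "\<omega> \<in> space R \<Longrightarrow> i \<ge> 1 \<Longrightarrow> C i \<omega> \<ge> 0"
  using space_mark_weight_nonneg[OF measurable_space[OF mark_vector_measurable], of \<omega> i]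
  by (simp add: mark_vector_def)

lemma toll_nonneg: "\<omega> \<in> space R \<Longrightarrow> Q \<omega> \<ge> 0"
  using measurable_space[OF mark_vector_measurable, of \<omega>]
  by (simp add: mark_vector_def mark_space_def space_pair_measure)

lemma measurable_esum_weights:
  fixes g :: "real \<Rightarrow> real"
  assumes [measurable]: "g \<in> borel_measurable borel"
  shows "(\<lambda>\<omega>. esum (N \<omega>) (\<lambda>i. g (C i \<omega>))) \<in> borel_measurable R"
    and "(\<lambda>\<omega>. esum (N \<omega>) (\<lambda>i. ennreal (g (C i \<omega>)))) \<in> borel_measurable R"
proof -
  have [measurable]: "C (Suc i) \<in> borel_measurable R" for i by (rule measurable_weight) simp
  note [measurable] = measurable_offspring
  show "(\<lambda>\<omega>. esum (N \<omega>) (\<lambda>i. g (C i \<omega>))) \<in> borel_measurable R"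
    and "(\<lambda>\<omega>. esum (N \<omega>) (\<lambda>i. ennreal (g (C i \<omega>)))) \<in> borel_measurable R"
    unfolding esum_def by measurable
qed

lemma esum_child_factor:
  "(\<integral>\<^sup>+i. child_factor \<alpha> (mark_vector N Q C \<omega>) i * \<phi> (snd (snd (mark_vector N Q C \<omega>)) i)
      \<partial>count_space {1..}) =
    esum (N \<omega>) (\<lambda>i. \<phi> (C i \<omega>) * ennreal (C i \<omega> powr \<alpha>))"
  unfolding esum_ennreal_eq_nn_integral
  by (intro nn_integral_cong) (auto simp: child_factor_def mark_vector_def mult.commute)

lemma nn_integral_total_factor:
  assumes [measurable]: "h \<in> borel_measurable mark_space"
  shows "(\<integral>\<^sup>+m. h m * total_factor \<alpha> m \<partial>distr R mark_space (mark_vector N Q C)) =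
    (\<integral>\<^sup>+\<omega>. h (mark_vector N Q C \<omega>) * esum (N \<omega>) (\<lambda>i. ennreal (C i \<omega> powr \<alpha>)) \<partial>R)"
proof -
  have "total_factor \<alpha> (mark_vector N Q C \<omega>) = esum (N \<omega>) (\<lambda>i. ennreal (C i \<omega> powr \<alpha>))" for \<omega>
    using esum_child_factor[of \<alpha> \<omega> "\<lambda>_. 1"] by (simp add: total_factor_def)
  then show ?thesis
    using mark_vector_measurable by (simp add: nn_integral_distr)
qed

lemma size_biased_mean_eq:
  assumes "\<And>i. i \<ge> 1 \<Longrightarrow> (\<lambda>m. \<phi> (snd (snd m) i)) \<in> borel_measurable mark_space"
  shows "size_biased_mean (distr R mark_space (mark_vector N Q C)) \<alpha> (\<lambda>m i. \<phi> (snd (snd m) i)) =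
    (\<integral>\<^sup>+\<omega>. esum (N \<omega>) (\<lambda>i. \<phi> (C i \<omega>) * ennreal (C i \<omega> powr \<alpha>)) \<partial>R)"
proof -
  have "(\<lambda>m. \<integral>\<^sup>+i. child_factor \<alpha> m i * \<phi> (snd (snd m) i) \<partial>count_space {1..})
      \<in> borel_measurable mark_space"
    by (intro measurable_nn_integral_children borel_measurable_times_ennreal
        measurable_child_factor assms)
  then show ?thesis
    unfolding size_biased_mean_def
    using mark_vector_measurable by (simp add: nn_integral_distr esum_child_factor del: One_nat_def)
qed

text \<open>Tonelli, together with \<open>log c \<le> x\<close> iff \<open>c \<le> e\<^sup>x\<close>, including the conventions at \<open>c = 0\<close> and
  \<open>x = \<plusminus>\<infinity>\<close>.\<close>

lemma spine_cdf_eq: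
  "spine_cdf R N C \<alpha> x =
    (\<integral>\<^sup>+\<omega>. esum (N \<omega>) (\<lambda>i. indicator {c. elog c \<le> x} (C i \<omega>) * ennreal (C i \<omega> powr \<alpha>)) \<partial>R)"
proof -
  let ?f = "\<lambda>i \<omega>. indicator {\<omega> \<in> space R. ereal (C i \<omega>) \<le> eexp x \<and> enat i \<le> N \<omega>} \<omega> *
    ennreal (C i \<omega> powr \<alpha>)"
  have "spine_cdf R N C \<alpha> x = (\<integral>\<^sup>+i. \<integral>\<^sup>+\<omega>. ?f i \<omega> \<partial>R \<partial>count_space {1..})"
    by (simp add: spine_cdf_def esum_ennreal_eq_nn_integral)
  also have "\<dots> = (\<integral>\<^sup>+\<omega>. \<integral>\<^sup>+i. ?f i \<omega> \<partial>count_space {1..} \<partial>R)"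
  proof (rule nn_integral_count_space_nn_integral[symmetric])
    fix i :: nat assume "i \<in> {1..}"
    then have [measurable]: "C i \<in> borel_measurable R" by (simp add: measurable_weight)
    note [measurable] = measurable_offspring
    show "?f i \<in> borel_measurable R" by measurable
  qed simp
  also have "\<dots> = (\<integral>\<^sup>+\<omega>. esum (N \<omega>)
      (\<lambda>i. indicator {c. elog c \<le> x} (C i \<omega>) * ennreal (C i \<omega> powr \<alpha>)) \<partial>R)"
    unfolding esum_ennreal_eq_nn_integral
    by (intro nn_integral_cong) (auto simp: elog_le_iff weight_nonneg split: split_indicator)
  finally show ?thesis .
qed

text \<open>The positive and the negative part of the series are summed and integrated separately, both being
  dominated by the integrable absolute series.\<close>

lemma integral_esum_weights:
  fixes g :: "real \<Rightarrow> real"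
  assumes g: "g \<in> borel_measurable borel"
    and fin: "(\<integral>\<^sup>+\<omega>. esum (N \<omega>) (\<lambda>i. ennreal \<bar>g (C i \<omega>)\<bar>) \<partial>R) < \<infinity>"
  shows "(\<integral>\<omega>. esum (N \<omega>) (\<lambda>i. g (C i \<omega>)) \<partial>R) =
    enn2real (\<integral>\<^sup>+\<omega>. esum (N \<omega>) (\<lambda>i. ennreal (g (C i \<omega>))) \<partial>R) -
    enn2real (\<integral>\<^sup>+\<omega>. esum (N \<omega>) (\<lambda>i. ennreal (- g (C i \<omega>))) \<partial>R)"
proof -
  let ?A = "\<lambda>\<omega>. esum (N \<omega>) (\<lambda>i. ennreal \<bar>g (C i \<omega>)\<bar>)"
  let ?S = "\<lambda>h \<omega>. esum (N \<omega>) (\<lambda>i. ennreal (h (C i \<omega>)))"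
  have g': "(\<lambda>x. - g x) \<in> borel_measurable borel" "(\<lambda>x. \<bar>g x\<bar>) \<in> borel_measurable borel"
    using g by measurable
  have A: "AE \<omega> in R. ?A \<omega> < \<infinity>"
    using nn_integral_PInf_AE[OF measurable_esum_weights(2)[OF g'(2)]] fin by (simp add: less_top)
  have part: "integrable R (\<lambda>\<omega>. enn2real (?S h \<omega>)) \<and>
      (\<integral>\<omega>. enn2real (?S h \<omega>) \<partial>R) = enn2real (\<integral>\<^sup>+\<omega>. ?S h \<omega> \<partial>R)"
    if h: "h \<in> borel_measurable borel" "\<And>x. h x \<le> \<bar>g x\<bar>" for h
  proof -
    have le: "?S h \<omega> \<le> ?A \<omega>" for \<omega>
      unfolding esum_ennreal_eq_nn_integral using h(2) by (intro nn_integral_mono) (simp add: ennreal_leI)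
    have "(\<integral>\<^sup>+\<omega>. ennreal (enn2real (?S h \<omega>)) \<partial>R) = (\<integral>\<^sup>+\<omega>. ?S h \<omega> \<partial>R)"
    proof (rule nn_integral_cong_AE, use A in eventually_elim)
      case (elim \<omega>)
      then show ?case using le_less_trans[OF le elim] by simp
    qed
    moreover have "(\<integral>\<^sup>+\<omega>. ?S h \<omega> \<partial>R) < \<infinity>"
      using nn_integral_mono[of R "?S h" ?A] le fin by (auto intro: le_less_trans)
    moreover have "(\<lambda>\<omega>. enn2real (?S h \<omega>)) \<in> borel_measurable R"
      using measurable_esum_weights(2)[OF h(1)] by measurable
    ultimately show ?thesis
      by (auto simp: integral_eq_nn_integral intro!: integrableI_nonneg)
  qed
  have "(\<integral>\<omega>. esum (N \<omega>) (\<lambda>i. g (C i \<omega>)) \<partial>R) =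
      (\<integral>\<omega>. enn2real (?S g \<omega>) - enn2real (?S (\<lambda>x. - g x) \<omega>) \<partial>R)"
  proof (rule integral_cong_AE)
    show "AE \<omega> in R. esum (N \<omega>) (\<lambda>i. g (C i \<omega>)) = enn2real (?S g \<omega>) - enn2real (?S (\<lambda>x. - g x) \<omega>)"
      using A by eventually_elim (rule esum_real_eq_diff)
  qed (use measurable_esum_weights(1)[OF g] measurable_esum_weights(2)[OF g]
      measurable_esum_weights(2)[OF g'(1)] in measurable)
  also have "\<dots> = enn2real (\<integral>\<^sup>+\<omega>. ?S g \<omega> \<partial>R) - enn2real (\<integral>\<^sup>+\<omega>. ?S (\<lambda>x. - g x) \<omega> \<partial>R)"
    using part[OF g] part[OF g'(1)] by (subst Bochner_Integration.integral_diff) auto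
  finally show ?thesis .
qed

end

text \<open>It remains to choose test functions: indicators of half-lines for the joint and the marginal laws,
  and the positive part, negative part and modulus of an increment for its mean.\<close>

theorem lemma2p6:
  fixes R :: "'b measure" and N :: "'b \<Rightarrow> enat" and Q :: "'b \<Rightarrow> real" and C :: "nat \<Rightarrow> 'b \<Rightarrow> real"
    and \<alpha> :: real
    and P Pt :: "'a measure" and \<psi> :: "nat list \<Rightarrow> 'a \<Rightarrow> mark" and J :: "nat \<Rightarrow> 'a \<Rightarrow> nat list"
  assumes "prob_space R"
    and "mark_vector N Q C \<in> measurable R mark_space"
    and "measure R {\<omega> \<in> space R. Q \<omega> > 0} > 0"
    and "\<alpha> > 0"
    and "(\<integral>\<^sup>+\<omega>. esum (N \<omega>) (\<lambda>i. ennreal (C i \<omega> powr \<alpha>)) \<partial>R) = 1"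
    and "(\<integral>\<^sup>+\<omega>. esum (N \<omega>) (\<lambda>i. ennreal \<bar>C i \<omega> powr \<alpha> * ln (C i \<omega>)\<bar>) \<partial>R) < \<infinity>"
    and "(\<integral>\<omega>. esum (N \<omega>) (\<lambda>i. C i \<omega> powr \<alpha> * ln (C i \<omega>)) \<partial>R) > 0"
    and "spine_change_of_measure P \<psi> (distr R mark_space (mark_vector N Q C)) \<alpha> J Pt"
  shows
    "(\<forall>(k::nat)\<ge>1. \<forall>(x::nat \<Rightarrow> ereal) (y::ereal).
        (\<forall>r\<in>{1..k}. x r \<noteq> -\<infinity>) \<longrightarrow> y \<noteq> -\<infinity> \<longrightarrow>
        emeasure Pt {\<omega> \<in> space Pt. (\<forall>r\<in>{1..k}. spine_step \<psi> J r \<omega> \<le> x r) \<and>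
                                     spine_perturbation \<psi> J k \<omega> \<le> y} =
        (\<integral>\<^sup>+\<omega>. indicator {\<omega> \<in> space R. ereal (Q \<omega>) \<le> eexp y} \<omega> *
               esum (N \<omega>) (\<lambda>i. ennreal (C i \<omega> powr \<alpha>)) \<partial>R) *
        (\<Prod>r=1..k. spine_cdf R N C \<alpha> (x r))) \<and>
     (\<forall>x::ereal. x \<noteq> -\<infinity> \<longrightarrow>
        spine_cdf R N C \<alpha> x =
        (\<integral>\<^sup>+\<omega>. esum (N \<omega>) (\<lambda>i. indicator {c. elog c \<le> x} (C i \<omega>) * ennreal (C i \<omega> powr \<alpha>)) \<partial>R)) \<and>
     prob_space.indep_vars Pt (\<lambda>_. borel) (spine_step \<psi> J) {1..} \<and>
     (\<forall>i\<ge>1. \<forall>x::ereal. x \<noteq> -\<infinity> \<longrightarrow>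
        emeasure Pt {\<omega> \<in> space Pt. spine_step \<psi> J i \<omega> \<le> x} = spine_cdf R N C \<alpha> x) \<and>
     (\<integral>\<^sup>+\<omega>. e2ennreal \<bar>spine_step \<psi> J 1 \<omega>\<bar> \<partial>Pt) < \<infinity> \<and>
     (\<forall>i\<ge>1. integrable Pt (\<lambda>\<omega>. real_of_ereal (spine_step \<psi> J i \<omega>)) \<and>
        (\<integral>\<omega>. real_of_ereal (spine_step \<psi> J i \<omega>) \<partial>Pt) =
        (\<integral>\<omega>. esum (N \<omega>) (\<lambda>i. C i \<omega> powr \<alpha> * ln (C i \<omega>)) \<partial>R)) \<and>
     (\<integral>\<omega>. real_of_ereal (spine_step \<psi> J 1 \<omega>) \<partial>Pt) > 0"
proof -
  interpret R: mark_vector_variable R N Q C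
    using assms(2) by (simp add: mark_vector_variable_def)
  let ?law = "distr R mark_space (mark_vector N Q C)"
  interpret S: spine_change_of_measure P \<psi> ?law \<alpha> J Pt by (rule assms(8))
  let ?l = "\<lambda>c::real. c powr \<alpha> * ln c"
  have l [measurable]: "?l \<in> borel_measurable borel" by measurable
  have one: "(\<integral>\<^sup>+m. total_factor \<alpha> m \<partial>?law) = 1"
    using R.nn_integral_total_factor[of "\<lambda>_. 1" \<alpha>] assms(5) by simp
  have step: "S.step_mean \<phi> =
      (\<integral>\<^sup>+\<omega>. esum (N \<omega>) (\<lambda>i. \<phi> (elog (C i \<omega>)) * ennreal (C i \<omega> powr \<alpha>)) \<partial>R)"
    if "\<phi> \<in> borel_measurable borel" for \<phi>
    unfolding S.step_mean_def
    by (rule R.size_biased_mean_eq[where \<phi> = "\<lambda>c. \<phi> (elog c)"])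
      (rule measurable_compose[OF S.measurable_elog_mark_weight that])
  have cdf: "S.step_mean (indicator {..x}) = spine_cdf R N C \<alpha> x" for x
    by (subst step) (simp_all add: R.spine_cdf_eq indicator_def)
  have mult: "ennreal a * ennreal (c powr \<alpha>) = ennreal (a * c powr \<alpha>)" for a c
    by (simp add: ennreal_mult'')
  \<comment> \<open>Positive part for \<open>s = 1\<close>, negative part for \<open>s = -1\<close>. A child with \<open>C\<^sub>i = 0\<close> contributes nothing,
    although \<open>log C\<^sub>i = -\<infinity>\<close>, since \<open>C\<^sub>i\<^sup>\<alpha> = 0\<close>.\<close>
  have pos: "(\<integral>\<^sup>+\<omega>. ennreal (s * real_of_ereal (spine_step \<psi> J i \<omega>)) \<partial>Pt) =
      (\<integral>\<^sup>+\<omega>. esum (N \<omega>) (\<lambda>i. ennreal (s * ?l (C i \<omega>))) \<partial>R)" if "i \<ge> 1" for s i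
  proof -
    have "(\<integral>\<^sup>+\<omega>. ennreal (s * real_of_ereal (spine_step \<psi> J i \<omega>)) \<partial>Pt) =
      (\<integral>\<^sup>+\<omega>. esum (N \<omega>) (\<lambda>i. ennreal (s * real_of_ereal (elog (C i \<omega>))) * ennreal (C i \<omega> powr \<alpha>)) \<partial>R)"
      using S.nn_integral_spine_step_marginal[OF one _ that, of "\<lambda>x. ennreal (s * real_of_ereal x)"]
      by (simp add: step)
    also have "\<dots> = (\<integral>\<^sup>+\<omega>. esum (N \<omega>) (\<lambda>i. ennreal (s * ?l (C i \<omega>))) \<partial>R)"
      by (intro nn_integral_cong arg_cong[where f = "esum _"] ext)
        (unfold mult, simp add: elog_def algebra_simps)
    finally show ?thesis .
  qed
  have abs: "(\<integral>\<^sup>+\<omega>. e2ennreal \<bar>spine_step \<psi> J i \<omega>\<bar> \<partial>Pt) < \<infinity>" if "i \<ge> 1" for i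
  proof -
    have "(\<integral>\<^sup>+\<omega>. e2ennreal \<bar>spine_step \<psi> J i \<omega>\<bar> \<partial>Pt) =
      (\<integral>\<^sup>+\<omega>. esum (N \<omega>) (\<lambda>i. e2ennreal \<bar>elog (C i \<omega>)\<bar> * ennreal (C i \<omega> powr \<alpha>)) \<partial>R)"
      using S.nn_integral_spine_step_marginal[OF one _ that, of "\<lambda>x. e2ennreal \<bar>x\<bar>"]
      by (simp add: step)
    also have "\<dots> = (\<integral>\<^sup>+\<omega>. esum (N \<omega>) (\<lambda>i. ennreal \<bar>?l (C i \<omega>)\<bar>) \<partial>R)"
      by (intro nn_integral_cong arg_cong[where f = "esum _"] ext)
        (auto simp: elog_def mult abs_mult mult.commute[of "_ powr _"])
    finally show ?thesis using assms(6) by simp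
  qed
  have int: "integrable Pt (\<lambda>\<omega>. real_of_ereal (spine_step \<psi> J i \<omega>))" if i: "i \<ge> 1" for i
  proof (rule integrableI_bounded)
    note [measurable] = S.measurable_spine_step[OF i]
    show "(\<lambda>\<omega>. real_of_ereal (spine_step \<psi> J i \<omega>)) \<in> borel_measurable Pt" by measurable
    have "ennreal (norm (real_of_ereal x)) \<le> e2ennreal \<bar>x\<bar>" for x by (cases x) auto
    then have "(\<integral>\<^sup>+\<omega>. ennreal (norm (real_of_ereal (spine_step \<psi> J i \<omega>))) \<partial>Pt) \<le>
        (\<integral>\<^sup>+\<omega>. e2ennreal \<bar>spine_step \<psi> J i \<omega>\<bar> \<partial>Pt)" by (intro nn_integral_mono)
    also have "\<dots> < \<infinity>" by (rule abs[OF i])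
    finally show "(\<integral>\<^sup>+\<omega>. ennreal (norm (real_of_ereal (spine_step \<psi> J i \<omega>))) \<partial>Pt) < \<infinity>" .
  qed
  have mean: "(\<integral>\<omega>. real_of_ereal (spine_step \<psi> J i \<omega>) \<partial>Pt) =
      (\<integral>\<omega>. esum (N \<omega>) (\<lambda>i. ?l (C i \<omega>)) \<partial>R)" if i: "i \<ge> 1" for i
    unfolding real_lebesgue_integral_def[OF int[OF i]] R.integral_esum_weights[OF l assms(6)]
    using pos[OF i, of 1] pos[OF i, of "-1"] by simp
  have marginal: "emeasure Pt {\<omega> \<in> space Pt. spine_step \<psi> J i \<omega> \<le> x} = spine_cdf R N C \<alpha> x"
    if i: "i \<ge> 1" for i x
  proof -
    note [measurable] = S.measurable_spine_step[OF i]
    have "emeasure Pt {\<omega> \<in> space Pt. spine_step \<psi> J i \<omega> \<le> x} =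
        (\<integral>\<^sup>+\<omega>. indicator {\<omega> \<in> space Pt. spine_step \<psi> J i \<omega> \<le> x} \<omega> \<partial>Pt)" by simp
    also have "\<dots> = (\<integral>\<^sup>+\<omega>. indicator {..x} (spine_step \<psi> J i \<omega>) \<partial>Pt)"
      by (intro nn_integral_cong) (auto split: split_indicator)
    also have "\<dots> = spine_cdf R N C \<alpha> x"
      by (simp add: S.nn_integral_spine_step_marginal[OF one _ i] cdf)
    finally show ?thesis .
  qed
  have joint: "emeasure Pt {\<omega> \<in> space Pt. (\<forall>r\<in>{1..k}. spine_step \<psi> J r \<omega> \<le> x r) \<and>
        spine_perturbation \<psi> J k \<omega> \<le> y} =
      (\<integral>\<^sup>+\<omega>. indicator {\<omega> \<in> space R. ereal (Q \<omega>) \<le> eexp y} \<omega> *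
        esum (N \<omega>) (\<lambda>i. ennreal (C i \<omega> powr \<alpha>)) \<partial>R) * (\<Prod>r=1..k. spine_cdf R N C \<alpha> (x r))" for k x y
  proof -
    let ?E = "{\<omega> \<in> space Pt. (\<forall>r\<in>{1..k}. spine_step \<psi> J r \<omega> \<le> x r) \<and> spine_perturbation \<psi> J k \<omega> \<le> y}"
    define h :: "mark \<Rightarrow> ennreal" where "h m = indicator {..y} (elog (fst (snd m)))" for m
    have h [measurable]: "h \<in> borel_measurable mark_space" unfolding h_def by measurable
    have pert: "spine_perturbation \<psi> J k \<omega> = elog (fst (snd (\<psi> (J k \<omega>) \<omega>)))" for \<omega>
      by (simp add: spine_perturbation_def toll_def)
    have [measurable]: "spine_perturbation \<psi> J k \<in> borel_measurable Pt"
      unfolding pert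
      by (rule measurable_compose[OF S.measurable_mark_along_spine, of "\<lambda>m. elog (fst (snd m))"]) measurable
    have "Measurable.pred Pt (\<lambda>\<omega>. spine_step \<psi> J r \<omega> \<le> x r)" if "r \<in> {1..k}" for r
    proof -
      have [measurable]: "spine_step \<psi> J r \<in> borel_measurable Pt"
        using that by (intro S.measurable_spine_step) simp
      show ?thesis by measurable
    qed
    then have [measurable]: "Measurable.pred Pt (\<lambda>\<omega>. \<forall>r\<in>{1..k}. spine_step \<psi> J r \<omega> \<le> x r)"
      by (intro pred_intros_finite) auto
    have "?E \<in> sets Pt" by measurable
    then have "emeasure Pt ?E = (\<integral>\<^sup>+\<omega>. indicator ?E \<omega> \<partial>Pt)"
      by (rule nn_integral_indicator[symmetric])
    also have "\<dots> = (\<integral>\<^sup>+\<omega>. (\<Prod>r=1..k. indicator {..x r} (spine_step \<psi> J r \<omega>)) * h (\<psi> (J k \<omega>) \<omega>) \<partial>Pt)"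
    proof (intro nn_integral_cong)
      fix \<omega> assume "\<omega> \<in> space Pt"
      moreover have "(\<Prod>r=1..k. indicator {..x r} (spine_step \<psi> J r \<omega>)) =
          (if \<forall>r\<in>{1..k}. spine_step \<psi> J r \<omega> \<le> x r then 1 else 0 :: ennreal)"
        by (auto simp: indicator_def intro!: prod.neutral)
      ultimately show "indicator ?E \<omega> =
          (\<Prod>r=1..k. indicator {..x r} (spine_step \<psi> J r \<omega>)) * h (\<psi> (J k \<omega>) \<omega>)"
        by (auto simp: h_def pert indicator_def)
    qed
    also have "\<dots> = (\<Prod>r=1..k. S.step_mean (indicator {..x r})) * (\<integral>\<^sup>+m. h m * total_factor \<alpha> m \<partial>?law)"
      by (rule S.nn_integral_spine_steps) (simp_all add: one h)
    also have "(\<integral>\<^sup>+m. h m * total_factor \<alpha> m \<partial>?law) =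
        (\<integral>\<^sup>+\<omega>. indicator {\<omega> \<in> space R. ereal (Q \<omega>) \<le> eexp y} \<omega> *
          esum (N \<omega>) (\<lambda>i. ennreal (C i \<omega> powr \<alpha>)) \<partial>R)"
      unfolding R.nn_integral_total_factor[OF h]
      by (intro nn_integral_cong)
        (simp add: h_def mark_vector_def elog_le_iff R.toll_nonneg indicator_def)
    finally show ?thesis by (simp add: cdf mult.commute)
  qed
  show ?thesis
    using joint R.spine_cdf_eq S.indep_vars_spine_step[OF one] marginal abs[of 1] int mean assms(7)
    by auto
qed

end
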